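(* There is an absolute constant $c$ such that for any fixed integers $d\geq 3$, $m\geq 1$, and all integers $n\geq 2$, $$g_d(n)\leq c\cdot (d+m)^{\frac{d+2m-1}{m}n}.$$
   Context: A finite set $P$ of (distinct, labelled) points in $\mathbb{R}^d$ is in general position if no $d+1$ of its points lie on the same hyperplane. A peeling sequence of $P$ is the sequence of labels obtained by the following process: in each step remove exactly one vertex of the convex hull of the current remaining point set and write down its label; repeat until all points of $P$ have been removed. For $P$ in general position in $\mathbb{R}^d$, $g_d(P)$ denotes the number of different peeling sequences of $P$, and $g_d(n)=\min_{|P|=n} g_d(P)$, where the minimum is taken over all $n$-element point sets $P$ in general position in $\mathbb{R}^d$. *)

theory Defs
  imports "HOL-Analysis.Analysis" "HOL-Library.Function_Algebras"
begin

text \<open>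
  The dimension is quantified inside the statement (the constant must not depend on it), so it
  cannot be a type. Euclidean d-space is therefore the set of real sequences that vanish from
  index d on. With the pointwise real vector space structure on functions, the library's convex
  hulls and extreme points apply to these vectors directly.
\<close>

instantiation "fun" :: (type, real_vector) real_vector
begin

definition scaleR_fun :: "real \<Rightarrow> ('a \<Rightarrow> 'b) \<Rightarrow> 'a \<Rightarrow> 'b"
  where "scaleR_fun r f = (\<lambda>x. r *\<^sub>R f x)"

instance
  by standard (auto simp: scaleR_fun_def fun_eq_iff algebra_simps)

end

definition Rn :: "nat \<Rightarrow> (nat \<Rightarrow> real) set"
  where "Rn d = {x. \<forall>i\<ge>d. x i = 0}"

definition hyperplane :: "nat \<Rightarrow> (nat \<Rightarrow> real) set \<Rightarrow> bool"
  where "hyperplane d H \<longleftrightarrow>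
    (\<exists>a b. (\<exists>i<d. a i \<noteq> 0) \<and> H = {x \<in> Rn d. (\<Sum>i<d. a i * x i) = b})"

definition general_position :: "nat \<Rightarrow> (nat \<Rightarrow> real) set \<Rightarrow> bool"
  where "general_position d P \<longleftrightarrow> finite P \<and> P \<subseteq> Rn d \<and>
    \<not> (\<exists>S H. S \<subseteq> P \<and> card S = d + 1 \<and> hyperplane d H \<and> S \<subseteq> H)"

text \<open>
  The points of a set are distinct, so they serve as their own labels. The vertices of the convex
  hull of a finite set are its extreme points, and these belong to the set.
\<close>

inductive peeling_sequence :: "'a::real_vector set \<Rightarrow> 'a list \<Rightarrow> bool" where
  "peeling_sequence {} []"
| "\<lbrakk>p extreme_point_of (convex hull P); peeling_sequence (P - {p}) ps\<rbrakk>
    \<Longrightarrow> peeling_sequence P (p # ps)"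

definition num_peelings :: "'a::real_vector set \<Rightarrow> nat"
  where "num_peelings P = card {ps. peeling_sequence P ps}"

text \<open>
  An infimum over a nonempty set of natural numbers, hence a minimum; nonemptiness is
  \<open>general_position_exists\<close> and finiteness of the counted set is
  \<open>finite_peeling_sequences\<close>, both below.
\<close>

definition min_peelings :: "nat \<Rightarrow> nat \<Rightarrow> nat"
  where "min_peelings d n = (INF P \<in> {P. general_position d P \<and> card P = n}. num_peelings P)"

lemma peeling_sequence_permutation:
  assumes "peeling_sequence P ps"
  shows "set ps = P \<and> distinct ps"
  using assms
proof (induction rule: peeling_sequence.induct)
  case (2 p P ps)
  have "p \<in> P"
    using 2(1) by (rule extreme_point_of_convex_hull)
  with 2 show ?case by auto
qed simp

lemma finite_peeling_sequences:
  assumes "finite P"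
  shows "finite {ps. peeling_sequence P ps}"
proof (rule finite_subset)
  show "{ps. peeling_sequence P ps} \<subseteq> {ps. set ps \<subseteq> P \<and> length ps = card P}"
    using peeling_sequence_permutation distinct_card by fastforce
  show "finite {ps. set ps \<subseteq> P \<and> length ps = card P}"
    using assms by (rule finite_lists_length_eq)
qed

text \<open>Points on the moment curve are in general position.\<close>

lemma general_position_exists:
  assumes "d \<ge> 1"
  shows "\<exists>P. general_position d P \<and> card P = n"
proof -
  define f :: "nat \<Rightarrow> nat \<Rightarrow> real" where "f k = (\<lambda>i. if i < d then real k ^ Suc i else 0)" for k
  have inj: "inj f"
  proof (rule injI)
    fix j k assume "f j = f k"
    from fun_cong[OF this, of 0] show "j = k" using assms by (simp add: f_def)
  qed
  define P where "P = f ` {..<n}"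
  have "card P = n"
    unfolding P_def using inj by (simp add: card_image inj_on_subset)
  moreover have "general_position d P"
    unfolding general_position_def
  proof (intro conjI notI)
    show "finite P" "P \<subseteq> Rn d" by (auto simp: P_def Rn_def f_def)
    assume "\<exists>S H. S \<subseteq> P \<and> card S = d + 1 \<and> hyperplane d H \<and> S \<subseteq> H"
    then obtain S a b i where S: "S \<subseteq> P" "card S = d + 1" "i < d" "a i \<noteq> 0"
      and H: "S \<subseteq> {x \<in> Rn d. (\<Sum>i<d. a i * x i) = b}"
      unfolding hyperplane_def by blast
    define c where "c j = (if j = 0 then - b else a (j - 1))" for j
    obtain K where K: "K \<subseteq> {..<n}" "S = f ` K"
      using S(1) unfolding P_def by (meson subset_imageE)
    have "card K = d + 1"
      using S(2) K(2) inj by (simp add: card_image inj_on_subset)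
    have root: "(\<Sum>j\<le>d. c j * real k ^ j) = 0" if "k \<in> K" for k
    proof -
      have "(\<Sum>i<d. a i * f k i) = b" using H K that by blast
      then show ?thesis
        by (simp add: f_def c_def lessThan_Suc_atMost[symmetric] sum.lessThan_Suc_shift
              del: sum.lessThan_Suc)
    qed
    have nz: "c (Suc i) \<noteq> 0" "Suc i \<le> d" using S by (auto simp: c_def)
    have fin: "finite {z::real. (\<Sum>j\<le>d. c j * z ^ j) = 0}"
      and le: "card {z::real. (\<Sum>j\<le>d. c j * z ^ j) = 0} \<le> d"
      using Transcendental.polyfun_rootbound[of c "Suc i" d] nz by auto
    have "card (real ` K) \<le> card {z::real. (\<Sum>j\<le>d. c j * z ^ j) = 0}"
      using root by (intro card_mono fin) auto
    then show False
      using le \<open>card K = d + 1\<close> by (simp add: card_image inj_on_def)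
  qed
  ultimately show ?thesis by blast
qed

end

theory Submission
  imports Defs "Jordan_Normal_Form.Determinant"
begin

text \<open>
  Put \<open>L = d + m\<close>, \<open>k = d + 2m - 1\<close> and \<open>C = L\<close> to the power \<open>k / m\<close>; the bound
  \<open>C ^ n\<close> holds with constant \<open>1\<close>.

  Gale's lemma gives \<open>k\<close> directions such that every open half-space contains at least \<open>m\<close> of
  them (\<open>gale_directions\<close>). Place a very flat affine copy of a good set of about
  \<open>n / k\<close> points far out in each direction; these copies are the arms. As long as at least
  \<open>k - m + 1 = L\<close> arms are inhabited, the inhabited directions surround the origin, and in each
  arm every point but the outermost one is an interior point of the hull: such a peeling step
  only chooses an arm. After \<open>m\<close> arms have died out, a step chooses one of the at most \<open>L - 1\<close>
  remaining arms and a step of the peeling inside that arm (\<open>arms_configuration\<close>). A constant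
  share \<open>m / k\<close> of the points is therefore removed before any recursive cost arises, and about
  \<open>L\<close> choices per point at every level add up to the exponent
  \<open>n (1 + (1 - m/k) + (1 - m/k)\<^sup>2 + \<dots>) = n k / m\<close>.

  To make this count exact, peelings are bounded by a potential: a function on sets of labels
  which dominates the sum of its values after each admissible removal and which falls by a factor
  of at least \<open>m + 1\<close> with every removed point. In the first phase the potential of the union
  sums, over all sets of \<open>L - 1\<close> arms that may survive, the product of the potentials of the
  survivors (with a factor \<open>L - 1\<close> per point) and of a factor \<open>m + 1\<close> per point of the other
  arms (\<open>potential_merge\<close>). The decay is what makes the weights balance:
  \<open>(L - 1) / ((m + 1)(L - 1)) + m / (m + 1) = 1\<close>.

  The gain at one level is at least \<open>4\<close> to the power \<open>\<lfloor>n/k\<rfloor>\<close>; it must pay for the choice of the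
  survivors and for the remainder of \<open>n\<close> modulo \<open>k\<close> (\<open>arms_bound_numeric\<close>,
  \<open>surplus_absorbed\<close>). It does so once the arms have about \<open>L\<^sup>2 / 2\<close> points. For smaller arms
  the trivial bound, a power of the number of points, stays below \<open>C\<close> by a factor of at least
  \<open>2\<close> per point and supplies the missing gain.

  Throughout, a point counts as hidden if every nonzero linear functional takes a larger value at
  another point. This condition survives small perturbations, so general position
  can be arranged by a final perturbation (\<open>general_position_perturbation\<close>), and in the
  perturbed set hidden points are not extreme (\<open>extreme_point_not_hidden\<close>).
\<close>

section \<open>Linear functionals and theorems of the alternative\<close>

definition dot :: "nat \<Rightarrow> (nat \<Rightarrow> real) \<Rightarrow> (nat \<Rightarrow> real) \<Rightarrow> real"
  where "dot d a x = (\<Sum>i<d. a i * x i)"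

lemma dot_linear [simp]:
  "dot d a (x + y) = dot d a x + dot d a y" "dot d a (x - y) = dot d a x - dot d a y"
  "dot d a (r *\<^sub>R x) = r * dot d a x" "dot d (a + b) x = dot d a x + dot d b x"
  "dot d (a - b) x = dot d a x - dot d b x" "dot d (r *\<^sub>R a) x = r * dot d a x" "dot d (- a) x = - dot d a x"
  by (simp_all add: dot_def scaleR_fun_def algebra_simps sum.distrib sum_subtractf sum_distrib_left
      sum_negf)

lemma dot_self_pos: "0 < dot d a a" if "i < d" "a i \<noteq> 0"
  unfolding dot_def using that by (intro sum_pos2[of _ i]) (auto simp: zero_less_mult_iff)

text \<open>
  Separation of a finite set from the origin has to be proved for coordinate vectors of varying
  dimension. The induction adds one vector \<open>u s\<close> to a separated family: if the separating
  functional is negative on \<open>u s\<close>, the other vectors are moved along \<open>u s\<close> into its kernel,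
  and the induction hypothesis is applied to the moved family.
\<close>

lemma gordan_alternative:
  assumes "finite T"
  shows "(\<exists>a. \<forall>t\<in>T. 0 < dot d a (u t)) \<or>
    (\<exists>l. (\<forall>t\<in>T. 0 \<le> l t) \<and> sum l T = 1 \<and> (\<forall>i<d. (\<Sum>t\<in>T. l t * u t i) = 0))"
  using assms
proof (induction T arbitrary: u rule: finite_induct)
  case empty
  show ?case by simp
next
  case (insert s T)
  let ?w = "u s"
  consider (comb) l where "\<forall>t\<in>T. 0 \<le> l t" "sum l T = 1" "\<forall>i<d. (\<Sum>t\<in>T. l t * u t i) = 0"
    | (sep) a where "\<forall>t\<in>T. 0 < dot d a (u t)"
    using insert.IH[of u] by blast
  then show ?case
  proof cases
    case comb
    have "(\<Sum>t\<in>T. (l(s := 0)) t * x t) = (\<Sum>t\<in>T. l t * x t)" for x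
      using insert.hyps(2) by (intro sum.cong) auto
    moreover have "sum (l(s := 0)) T = sum l T"
      using insert.hyps(2) by (intro sum.cong) auto
    ultimately show ?thesis
      using comb insert.hyps
      by (intro disjI2 exI[of _ "l(s := 0)"]) (auto simp: sum.insert simp del: fun_upd_apply, auto)
  next
    case sep
    (* A functional that is positive on T and zero at u s becomes positive everywhere after adding
    a small multiple of one that is positive at u s. *)
    have tilt: ?thesis if b: "\<forall>t\<in>T. 0 < dot d b (u t)" "dot d b ?w = 0" and c: "0 < dot d c ?w" for b c
    proof -
      define e where "e = Min (insert 1 ((\<lambda>t. dot d b (u t) / (\<bar>dot d c (u t)\<bar> + 1)) ` T))"
      have e: "0 < e" unfolding e_def using insert.hyps(1) b by (subst Min_gr_iff) auto
      have "0 < dot d (b + e *\<^sub>R c) (u t)" if "t \<in> T" for t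
      proof -
        have "e \<le> dot d b (u t) / (\<bar>dot d c (u t)\<bar> + 1)"
          unfolding e_def using that insert.hyps(1) by (intro Min_le) auto
        then have "e * (\<bar>dot d c (u t)\<bar> + 1) \<le> dot d b (u t)"
          by (simp add: pos_le_divide_eq)
        moreover have "0 \<le> e * (\<bar>dot d c (u t)\<bar> + dot d c (u t))"
          using e by (intro mult_nonneg_nonneg) auto
        ultimately show ?thesis using e by (simp only: dot_linear distrib_left mult_1_right)
      qed
      moreover have "0 < dot d (b + e *\<^sub>R c) ?w"
        using b c e by (simp only: dot_linear) simp
      ultimately show ?thesis by (intro disjI1 exI[of _ "b + e *\<^sub>R c"]) blast
    qed
    consider (pos) "0 < dot d a ?w" | (zero) "dot d a ?w = 0" | (neg) "dot d a ?w < 0" by linarith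
    then show ?thesis
    proof cases
      case pos
      then show ?thesis using sep by auto
    next
      case zero
      show ?thesis
      proof (cases "\<exists>i<d. ?w i \<noteq> 0")
        case True
        then show ?thesis using tilt[OF sep zero, of ?w] dot_self_pos by blast
      next
        case False
        then show ?thesis
          using insert.hyps by (intro disjI2 exI[of _ "\<lambda>t. if t = s then 1 else 0"])
            (auto simp: sum.insert intro!: sum.neutral)
      qed
    next
      case neg
      (* The multiple of u s that moves u t into the kernel of a. *)
      define r where "r t = - dot d a (u t) / dot d a ?w" for t
      have r: "0 < r t" if "t \<in> T" for t
        using divide_pos_neg[of "dot d a (u t)" "dot d a ?w"] sep that neg by (simp add: r_def)
      consider (comb) l where "\<forall>t\<in>T. 0 \<le> l t" "sum l T = 1"
          "\<forall>i<d. (\<Sum>t\<in>T. l t * (u t + r t *\<^sub>R ?w) i) = 0"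
        | (sep) b where "\<forall>t\<in>T. 0 < dot d b (u t + r t *\<^sub>R ?w)"
        using insert.IH[of "\<lambda>t. u t + r t *\<^sub>R ?w"] by blast
      then show ?thesis
      proof cases
        case comb
        define m where "m = (\<Sum>t\<in>T. l t * r t)"
        have m: "0 \<le> m" unfolding m_def using comb r by (intro sum_nonneg) (simp add: less_imp_le)
        let ?l = "\<lambda>t. (if t = s then m else l t) / (1 + m)"
        have S: "(\<Sum>t\<in>insert s T. ?l t * x t) = ((\<Sum>t\<in>T. l t * x t) + m * x s) / (1 + m)" for x
        proof -
          have "(\<Sum>t\<in>T. ?l t * x t) = (\<Sum>t\<in>T. l t * x t / (1 + m))"
            using insert.hyps(2) by (intro sum.cong) auto
          then show ?thesis using insert.hyps
            by (simp add: sum.insert add_divide_distrib sum_divide_distrib)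
        qed
        have "(\<Sum>t\<in>insert s T. ?l t * u t i) = 0" if "i < d" for i
        proof -
          have "(\<Sum>t\<in>T. l t * (u t + r t *\<^sub>R ?w) i) = (\<Sum>t\<in>T. l t * u t i) + m * u s i"
            by (simp add: m_def scaleR_fun_def algebra_simps sum.distrib sum_distrib_left sum_distrib_right)
          then show ?thesis using comb that unfolding S by simp
        qed
        moreover have "sum ?l (insert s T) = 1"
          using S[of "\<lambda>_. 1"] comb m by (simp del: sum.insert)
        moreover have "\<forall>t\<in>insert s T. 0 \<le> ?l t" using comb m by auto
        ultimately show ?thesis by (intro disjI2 exI[of _ ?l]) blast
      next
        case sep: sep
        define b' where "b' = b + (- dot d b ?w / dot d a ?w) *\<^sub>R a"
        have "dot d b' ?w = 0" using neg by (simp add: b'_def)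
        moreover have "dot d b' (u t) = dot d b (u t + r t *\<^sub>R ?w)" for t
          by (simp add: b'_def r_def)
        ultimately show ?thesis using tilt[of b' "- a"] sep neg by simp
      qed
    qed
  qed
qed

section \<open>Interior points and their stability\<close>

text \<open>
  For \<open>p\<close> in \<open>Q\<close>, this says that \<open>f p\<close> lies in the interior of the convex hull of \<open>f ` Q\<close>
  in dimension \<open>d\<close>. Stated with functionals, the condition is visibly invariant under invertible
  affine maps.
\<close>

definition hidden :: "nat \<Rightarrow> ('p \<Rightarrow> nat \<Rightarrow> real) \<Rightarrow> 'p set \<Rightarrow> 'p \<Rightarrow> bool"
  where "hidden d f Q p \<longleftrightarrow>
    (\<forall>a. (\<exists>i<d. a i \<noteq> 0) \<longrightarrow> (\<exists>q\<in>Q. dot d a (f p) < dot d a (f q)))"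

text \<open>
  An extreme point is not in the hull of the other points, so Gordan's alternative yields a
  functional whose strict maximum it is.
\<close>

lemma extreme_point_not_hidden:
  assumes Q: "finite Q" "x \<in> Q" and inj: "inj_on g Q" and Rn: "g ` Q \<subseteq> Rn d" and d: "d \<ge> 1"
    and ext: "g x extreme_point_of convex hull (g ` Q)"
  shows "\<not> hidden d g Q x"
proof
  assume hid: "hidden d g Q x"
  define T where "T = Q - {x}"
  have T: "finite T" "T \<subseteq> Q" using Q by (auto simp: T_def)
  from gordan_alternative[OF T(1), of d "\<lambda>t. g t - g x"] consider
      (sep) a where "\<forall>t\<in>T. 0 < dot d a (g t - g x)"
    | (comb) l where "\<forall>t\<in>T. 0 \<le> l t" "sum l T = 1" "\<forall>i<d. (\<Sum>t\<in>T. l t * (g t - g x) i) = 0"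
    by blast
  then show False
  proof cases
    case sep
    obtain b where b: "\<exists>i<d. b i \<noteq> 0" "\<forall>t\<in>T. dot d b (g t) < dot d b (g x)"
    proof (cases "T = {}")
      case True
      then show ?thesis using that[of "\<lambda>_. 1"] d by (auto simp: Suc_le_eq)
    next
      case False
      then obtain t where "0 < dot d a (g t - g x)" using sep by blast
      then have "\<exists>i<d. a i \<noteq> 0" unfolding dot_def
        by (metis (no_types, lifting) lessThan_iff less_irrefl mult_zero_left sum.neutral)
      then show ?thesis using that[of "- a"] sep by auto
    qed
    then obtain q where "q \<in> Q" "dot d b (g x) < dot d b (g q)"
      using hid unfolding hidden_def by blast
    then show False using b(2) unfolding T_def by (metis insert_Diff_single insert_iff order_less_asym)
  next
    case comb
    have "(\<Sum>t\<in>T. l t *\<^sub>R g t) i = g x i" for i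
    proof (cases "i < d")
      case True
      have "(\<Sum>t\<in>T. l t * (g t - g x) i) = (\<Sum>t\<in>T. l t * g t i) - sum l T * g x i"
        by (simp add: algebra_simps sum_subtractf sum_distrib_left sum_distrib_right)
      moreover have "(\<Sum>t\<in>T. l t *\<^sub>R g t) i = (\<Sum>t\<in>T. l t * g t i)"
        using T(1) by (induction T rule: finite_induct) (auto simp: scaleR_fun_def)
      ultimately show ?thesis using comb True by simp
    next
      case False
      then have "g t i = 0" if "t \<in> Q" for t using Rn that by (auto simp: Rn_def)
      moreover have "(\<Sum>t\<in>T. l t *\<^sub>R g t) i = (\<Sum>t\<in>T. l t * g t i)"
        using T(1) by (induction T rule: finite_induct) (auto simp: scaleR_fun_def)
      ultimately show ?thesis using T Q by (simp add: subset_iff)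
    qed
    then have eq: "(\<Sum>t\<in>T. l t *\<^sub>R g t) = g x" by blast
    have "convex (convex hull (g ` Q) - {g x})"
      using ext by (simp add: extreme_point_of_stillconvex)
    moreover have "g t \<in> convex hull (g ` Q) - {g x}" if "t \<in> T" for t
      using that T inj Q by (auto simp: T_def hull_inc dest: inj_onD)
    ultimately have "(\<Sum>t\<in>T. l t *\<^sub>R g t) \<in> convex hull (g ` Q) - {g x}"
      using comb T by (intro convex_sum) auto
    then show False using eq by simp
  qed
qed

text \<open>
  By homogeneity the functionals may be taken of \<open>\<ell>\<^sup>1\<close>-norm \<open>1\<close>. These form a compact set, a
  closed subset of a product of intervals, on which the sum of the positive parts attains a positive
  minimum.
\<close>

lemma uniform_positive_direction:
  assumes T: "finite T"
    and pos: "\<And>a. \<exists>i<d. a i \<noteq> 0 \<Longrightarrow> \<exists>t\<in>T. 0 < dot d a (v t)"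
  shows "\<exists>e>0. \<forall>a. (\<exists>i<d. a i \<noteq> 0) \<longrightarrow> (\<exists>t\<in>T. e * (\<Sum>i<d. \<bar>a i\<bar>) \<le> dot d a (v t))"
proof (cases "d = 0")
  case True
  then show ?thesis by (intro exI[of _ 1]) auto
next
  case False
  define K :: "(nat \<Rightarrow> real) set" where "K = (\<Pi>\<^sub>E i\<in>UNIV. if i < d then {-1..1} else {0})"
  define N :: "(nat \<Rightarrow> real) \<Rightarrow> real" where "N a = (\<Sum>i<d. \<bar>a i\<bar>)" for a
  have coord: "continuous_on A (\<lambda>a::nat \<Rightarrow> real. a i)" for A i
    by (rule continuous_on_subset[OF continuous_on_product_coordinates]) simp
  have "compactin euclidean K"
    unfolding K_def euclidean_product_topology[symmetric] by (auto simp: compactin_PiE)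
  then have "compact K" by simp
  moreover have "closed {a. N a = 1}"
    unfolding N_def by (intro closed_Collect_eq continuous_intros coord)
  ultimately have comp: "compact (K \<inter> {a. N a = 1})" by (rule compact_Int_closed)
  have nonempty: "K \<inter> {a. N a = 1} \<noteq> {}"
  proof -
    define b :: "nat \<Rightarrow> real" where "b i = (if i = 0 then 1 else 0)" for i
    have "N b = (\<Sum>i<d. if i = 0 then 1 else 0)" unfolding N_def by (intro sum.cong) (auto simp: b_def)
    then have "N b = 1" using False by simp
    moreover have "b \<in> K" using False by (auto simp: K_def b_def)
    ultimately show ?thesis by blast
  qed
  define \<phi> where "\<phi> a = (\<Sum>t\<in>T. max 0 (dot d a (v t)))" for a
  have "continuous_on (K \<inter> {a. N a = 1}) \<phi>"
    unfolding \<phi>_def dot_def by (intro continuous_intros coord)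
  from continuous_attains_inf[OF comp nonempty this] obtain b
    where b: "N b = 1" and min: "\<And>a. a \<in> K \<Longrightarrow> N a = 1 \<Longrightarrow> \<phi> b \<le> \<phi> a" by auto
  have "\<exists>i<d. b i \<noteq> 0"
  proof (rule ccontr)
    assume "\<not> ?thesis"
    then have "N b = 0" by (simp add: N_def)
    then show False using b by simp
  qed
  then obtain t where t: "t \<in> T" "0 < dot d b (v t)" using pos by blast
  have "0 < \<phi> b" unfolding \<phi>_def using t T by (intro sum_pos2[of _ t]) auto
  define e where "e = \<phi> b / real (card T)"
  have cT: "0 < card T" using t T by (auto simp: card_gt_0_iff)
  have e: "0 < e" using \<open>0 < \<phi> b\<close> cT by (simp add: e_def)
  have "\<exists>t\<in>T. e * N a \<le> dot d a (v t)" if a: "\<exists>i<d. a i \<noteq> 0" for a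
  proof (rule ccontr)
    assume small: "\<not> ?thesis"
    have Na: "0 < N a" using a unfolding N_def by (auto intro: sum_pos2)
    define a' where "a' i = (if i < d then a i / N a else 0)" for i
    have le: "\<bar>a i\<bar> \<le> N a" if "i < d" for i
      unfolding N_def using that by (intro member_le_sum) auto
    have "\<bar>a' i\<bar> \<le> 1" if "i < d" for i
      using le[OF that] Na that by (simp add: a'_def)
    then have "a' i \<in> (if i < d then {-1..1} else {0})" for i
      by (cases "i < d") (force simp: abs_le_iff, simp add: a'_def)
    then have a'K: "a' \<in> K" unfolding K_def by (simp add: PiE_iff del: PiE_UNIV_domain)
    have "N a' = (\<Sum>i<d. \<bar>a i\<bar> / N a)" using Na by (simp add: N_def a'_def)
    then have Na': "N a' = 1" using Na by (simp add: N_def flip: sum_divide_distrib)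
    have da: "dot d a' x = dot d a x / N a" for x
      by (simp add: dot_def a'_def sum_divide_distrib)
    have "max 0 (dot d a' (v t)) < e" if "t \<in> T" for t
    proof -
      have "dot d a (v t) < e * N a" using small that by (auto simp: not_le)
      then show ?thesis using Na e by (simp add: da divide_less_eq)
    qed
    then have "\<phi> a' < (\<Sum>t\<in>T. e)"
      unfolding \<phi>_def using T t by (intro sum_strict_mono) auto
    also have "\<dots> = \<phi> b" using cT by (simp add: e_def)
    finally show False using min[OF a'K Na'] by simp
  qed
  then show ?thesis using e unfolding N_def by blast
qed

lemma abs_dot_le:
  assumes "\<And>i. i < d \<Longrightarrow> \<bar>x i\<bar> \<le> M"
  shows "\<bar>dot d a x\<bar> \<le> M * (\<Sum>i<d. \<bar>a i\<bar>)"
proof -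
  have "\<bar>dot d a x\<bar> \<le> (\<Sum>i<d. \<bar>a i\<bar> * \<bar>x i\<bar>)"
    unfolding dot_def by (rule order_trans[OF sum_abs]) (simp add: abs_mult)
  also have "\<dots> \<le> (\<Sum>i<d. \<bar>a i\<bar> * M)" using assms by (intro sum_mono mult_left_mono) auto
  finally show ?thesis by (simp add: mult.commute sum_distrib_left)
qed

text \<open>
  The witnesses against a hidden point beat it by a margin proportional to the norm of the
  functional, uniformly in the functional, and a small perturbation cannot use up the margin.
\<close>

lemma eventually_hidden_perturb:
  assumes I: "finite Q" "p \<in> Q" and hid: "hidden d f Q p"
  shows "eventually (\<lambda>\<delta>. hidden d (\<lambda>q. f q + \<delta> *\<^sub>R u q) Q p) (at_right 0)"
proof -
  have "\<exists>q\<in>Q. 0 < dot d a (f q - f p)" if "\<exists>i<d. a i \<noteq> 0" for a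
    using hid that unfolding hidden_def by simp
  from uniform_positive_direction[OF I(1) this] obtain e where e: "0 < e"
    and far: "\<And>a. \<exists>i<d. a i \<noteq> 0 \<Longrightarrow> \<exists>q\<in>Q. e * (\<Sum>i<d. \<bar>a i\<bar>) \<le> dot d a (f q - f p)" by blast
  define M where "M = (\<Sum>q\<in>Q. \<Sum>i<d. \<bar>(u q - u p) i\<bar>)"
  have M: "\<bar>(u q - u p) i\<bar> \<le> M" if "q \<in> Q" "i < d" for q i
  proof -
    have "\<bar>(u q - u p) i\<bar> \<le> (\<Sum>i<d. \<bar>(u q - u p) i\<bar>)"
      using that by (intro member_le_sum) auto
    also have "\<dots> \<le> M" unfolding M_def using that I
      by (intro member_le_sum[of q Q "\<lambda>q. \<Sum>i<d. \<bar>(u q - u p) i\<bar>"]) (auto intro: sum_nonneg)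
    finally show ?thesis .
  qed
  have "0 \<le> M" unfolding M_def by (intro sum_nonneg) auto
  have "hidden d (\<lambda>q. f q + \<delta> *\<^sub>R u q) Q p" if \<delta>: "0 < \<delta>" "\<delta> < e / (M + 1)" for \<delta>
    unfolding hidden_def
  proof (intro allI impI)
    fix a :: "nat \<Rightarrow> real" assume a: "\<exists>i<d. a i \<noteq> 0"
    obtain q where q: "q \<in> Q" "e * (\<Sum>i<d. \<bar>a i\<bar>) \<le> dot d a (f q - f p)" using far[OF a] by blast
    have N: "0 < (\<Sum>i<d. \<bar>a i\<bar>)" using a by (auto intro: sum_pos2)
    have "\<delta> * \<bar>dot d a (u q - u p)\<bar> \<le> \<delta> * (M * (\<Sum>i<d. \<bar>a i\<bar>))"
      using \<delta> M[OF q(1)] by (intro mult_left_mono abs_dot_le) auto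
    also have "\<dots> < e * (\<Sum>i<d. \<bar>a i\<bar>)"
    proof -
      have "\<delta> * (M + 1) < e" using \<delta> \<open>0 \<le> M\<close> by (simp add: pos_less_divide_eq)
      then have "\<delta> * M < e" using \<delta> by (simp add: distrib_left)
      then show ?thesis using N by (simp flip: mult.assoc)
    qed
    finally have "\<bar>\<delta> * dot d a (u q - u p)\<bar> < dot d a (f q - f p)"
      using q \<delta> by (simp add: abs_mult)
    then have "dot d a (f p + \<delta> *\<^sub>R u p) < dot d a (f q + \<delta> *\<^sub>R u q)"
      by (simp add: algebra_simps)
    then show "\<exists>q\<in>Q. dot d a (f p + \<delta> *\<^sub>R u p) < dot d a (f q + \<delta> *\<^sub>R u q)" using q by blast
  qed
  then show ?thesis
    using e \<open>0 \<le> M\<close> unfolding eventually_at_right_field by (intro exI[of _ "e / (M + 1)"]) auto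
qed

section \<open>Perturbation into general position\<close>

text \<open>
  Being on a common hyperplane is the vanishing of a determinant which is a polynomial in \<open>s\<close>. It
  is not the zero polynomial because at \<open>s = 0\<close> only the points \<open>\<mu> p\<close> remain, which lie on
  no common hyperplane.
\<close>

lemma on_hyperplane_finite_parameters:
  fixes f \<mu> :: "'p \<Rightarrow> nat \<Rightarrow> real"
  assumes S: "card S = d + 1" and d: "d \<ge> 1"
    and gp: "\<And>a b. \<exists>i<d. a i \<noteq> 0 \<Longrightarrow> \<exists>p\<in>S. dot d a (\<mu> p) \<noteq> b"
  shows "finite {s. \<exists>a b. (\<exists>i<d. a i \<noteq> 0) \<and> (\<forall>p\<in>S. dot d a (\<mu> p + s *\<^sub>R f p) = b)}"
proof -
  have "finite S" using S by (intro card_ge_0_finite) simp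
  then obtain e where e: "bij_betw e {..<d + 1} S"
    using ex_bij_betw_nat_finite[of S] unfolding S atLeast0LessThan by blast
  define A :: "real poly mat" where
    "A = mat (d + 1) (d + 1) (\<lambda>(r, c). if c < d then [:\<mu> (e r) c, f (e r) c:] else 1)"
  have A: "A \<in> carrier_mat (d + 1) (d + 1)" by (simp add: A_def)
  define As where "As s = map_mat (\<lambda>p. poly p s) A" for s
  have As: "As s \<in> carrier_mat (d + 1) (d + 1)" for s using A by (simp add: As_def)
  have det: "poly (det A) s = det (As s)" for s
  proof -
    interpret comm_ring_hom "\<lambda>p::real poly. poly p s" by unfold_locales auto
    show ?thesis by (simp add: As_def)
  qed
  have prod: "(As s *\<^sub>v v) $ r = dot d (\<lambda>i. v $ i) (\<mu> (e r) + s *\<^sub>R f (e r)) + v $ d"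
    if "r < d + 1" "v \<in> carrier_vec (d + 1)" for r s v
  proof -
    have "(As s *\<^sub>v v) $ r = (\<Sum>c<d + 1. As s $$ (r, c) * v $ c)"
      using that As[of s] by (simp add: scalar_prod_def atLeast0LessThan)
    also have "\<dots> = (\<Sum>c<d. As s $$ (r, c) * v $ c) + As s $$ (r, d) * v $ d" by simp
    also have "As s $$ (r, d) = 1" using that by (simp add: As_def A_def)
    also have "(\<Sum>c<d. As s $$ (r, c) * v $ c) = dot d (\<lambda>i. v $ i) (\<mu> (e r) + s *\<^sub>R f (e r))"
      unfolding dot_def using that
      by (intro sum.cong) (auto simp: As_def A_def scaleR_fun_def algebra_simps)
    finally show ?thesis by simp
  qed
  have "det A \<noteq> 0"
  proof
    assume "det A = 0"
    then have "det (As 0) = 0" using det[of 0] by simp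
    then obtain v where v: "v \<in> carrier_vec (d + 1)" "v \<noteq> 0\<^sub>v (d + 1)" "As 0 *\<^sub>v v = 0\<^sub>v (d + 1)"
      using det_0_iff_vec_prod_zero[OF As] by blast
    have eq: "dot d (\<lambda>i. v $ i) (\<mu> p) = - v $ d" if p: "p \<in> S" for p
    proof -
      obtain r where "r < d + 1" "p = e r"
        using e p unfolding bij_betw_def by blast
      then show ?thesis using prod[of r v 0] v by (simp add: add_eq_0_iff2)
    qed
    show False
    proof (cases "\<exists>i<d. v $ i \<noteq> 0")
      case True
      then show False using gp[of "\<lambda>i. v $ i" "- v $ d"] eq by blast
    next
      case False
      obtain p where "p \<in> S" using S by fastforce
      have "v $ d = 0" using eq[OF \<open>p \<in> S\<close>] False by (simp add: dot_def)
      then have "v = 0\<^sub>v (d + 1)" using v(1) False by (intro eq_vecI) (auto simp: less_Suc_eq)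
      then show False using v(2) by simp
    qed
  qed
  then have "finite {s. poly (det A) s = 0}" by (rule poly_roots_finite)
  moreover have "poly (det A) s = 0"
    if ab: "\<exists>i<d. a i \<noteq> 0" "\<forall>p\<in>S. dot d a (\<mu> p + s *\<^sub>R f p) = b" for s a b
  proof -
    define v where "v = vec (d + 1) (\<lambda>i. if i < d then a i else - b)"
    have v: "v \<in> carrier_vec (d + 1)" by (simp add: v_def)
    have "v \<noteq> 0\<^sub>v (d + 1)"
    proof
      obtain i where "i < d" "a i \<noteq> 0" using ab by blast
      moreover assume "v = 0\<^sub>v (d + 1)"
      then have "v $ i = 0" using \<open>i < d\<close> by simp
      ultimately show False by (simp add: v_def)
    qed
    moreover have "As s *\<^sub>v v = 0\<^sub>v (d + 1)"
    proof (rule eq_vecI)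
      fix r assume "r < dim_vec (0\<^sub>v (d + 1) :: real vec)"
      then have r: "r < d + 1" by simp
      then have "e r \<in> S" using e unfolding bij_betw_def by blast
      moreover have "dot d (\<lambda>i. v $ i) x = dot d a x" for x by (simp add: dot_def v_def)
      ultimately show "(As s *\<^sub>v v) $ r = 0\<^sub>v (d + 1) $ r"
        using prod[OF r v, of s] ab r by (simp add: v_def)
    qed (use As[of s] in simp)
    ultimately have "det (As s) = 0" using det_0_iff_vec_prod_zero[OF As] v by blast
    then show ?thesis by (simp add: det)
  qed
  ultimately show ?thesis by (blast intro: finite_subset[rotated])
qed

lemma eventually_avoids_finite:
  assumes "finite X"
  shows "eventually (\<lambda>\<delta>::real. \<delta> \<notin> X) (at_right 0)"
proof -
  have "eventually (\<lambda>\<delta>. \<forall>x\<in>X. \<delta> \<noteq> x) (at_right 0)"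
    using assms by (intro eventually_ball_finite ballI eventually_neq_at_within)
  then show ?thesis by (rule eventually_mono) blast
qed

text \<open>
  Move \<open>f\<close> by \<open>\<delta>\<close> times a set in general position. Up to scaling by \<open>1 / \<delta>\<close> this
  is the family of \<open>on_hyperplane_finite_parameters\<close> with \<open>s = 1 / \<delta>\<close>, so only finitely many \<open>\<delta>\<close>
  are bad, while all small \<open>\<delta>\<close> keep the hidden points hidden.
\<close>

lemma general_position_perturbation:
  assumes I: "finite I" and d: "d \<ge> 1"
  obtains g where "inj_on g I" "general_position d (g ` I)"
    "\<And>Q p. Q \<subseteq> I \<Longrightarrow> p \<in> Q \<Longrightarrow> hidden d f Q p \<Longrightarrow> hidden d g Q p"
proof -
  obtain P where P: "general_position d P" "card P = card I"
    using general_position_exists[OF d] by blast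
  then have "finite P" by (simp add: general_position_def)
  then obtain \<mu> where \<mu>: "bij_betw \<mu> I P" using finite_same_card_bij[OF I \<open>finite P\<close>] P(2) by auto
  define f' where "f' p = (\<lambda>i. if i < d then f p i else 0)" for p
  have f': "dot d a (f' p) = dot d a (f p)" for a p by (simp add: dot_def f'_def)
  define g where "g \<delta> p = f' p + \<delta> *\<^sub>R \<mu> p" for \<delta> p
  have gRn: "g \<delta> ` I \<subseteq> Rn d" for \<delta>
  proof (rule image_subsetI)
    fix p assume "p \<in> I"
    then have "\<mu> p \<in> Rn d" using P(1) bij_betwE[OF \<mu>] unfolding general_position_def by blast
    then show "g \<delta> p \<in> Rn d" by (simp add: Rn_def g_def f'_def scaleR_fun_def)
  qed
  have hid: "eventually (\<lambda>\<delta>. \<forall>Q\<in>Pow I. \<forall>p\<in>Q. hidden d f Q p \<longrightarrow> hidden d (g \<delta>) Q p) (at_right 0)"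
  proof (intro eventually_ball_finite ballI)
    fix Q p assume Q: "Q \<in> Pow I" and p: "p \<in> Q"
    then have "finite Q" using I finite_subset by blast
    then show "eventually (\<lambda>\<delta>. hidden d f Q p \<longrightarrow> hidden d (g \<delta>) Q p) (at_right 0)"
      using eventually_hidden_perturb[of Q p d f' \<mu>] p
      by (cases "hidden d f Q p") (auto simp: hidden_def f' g_def)
  qed (use I finite_subset in auto)
  have inj: "eventually (\<lambda>\<delta>. \<forall>p\<in>I. \<forall>q\<in>I. p \<noteq> q \<longrightarrow> g \<delta> p \<noteq> g \<delta> q) (at_right 0)"
  proof (intro eventually_ball_finite ballI I)
    fix p q assume pq: "p \<in> I" "q \<in> I"
    show "eventually (\<lambda>\<delta>. p \<noteq> q \<longrightarrow> g \<delta> p \<noteq> g \<delta> q) (at_right 0)"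
    proof (cases "p = q")
      case False
      then have "\<mu> p \<noteq> \<mu> q" using \<mu> pq by (auto simp: bij_betw_def dest: inj_onD)
      then obtain i where i: "\<mu> p i \<noteq> \<mu> q i" by blast
      have "g \<delta> p \<noteq> g \<delta> q" if "\<delta> \<noteq> (f' q i - f' p i) / (\<mu> p i - \<mu> q i)" for \<delta>
      proof
        assume "g \<delta> p = g \<delta> q"
        then have "g \<delta> p i = g \<delta> q i" by simp
        then have "\<delta> * (\<mu> p i - \<mu> q i) = f' q i - f' p i"
          by (simp add: g_def scaleR_fun_def algebra_simps)
        then show False using that i by (simp add: eq_divide_eq)
      qed
      then have "p \<noteq> q \<longrightarrow> g \<delta> p \<noteq> g \<delta> q" if "\<delta> \<noteq> (f' q i - f' p i) / (\<mu> p i - \<mu> q i)" for \<delta>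
        using that by blast
      then show ?thesis by (rule eventually_mono[OF eventually_neq_at_within])
    qed simp
  qed
  define cohyp where "cohyp \<delta> S \<longleftrightarrow> (\<exists>a b. (\<exists>i<d. a i \<noteq> 0) \<and> (\<forall>p\<in>S. dot d a (g \<delta> p) = b))" for \<delta> S
  define SS where "SS = {S. S \<subseteq> I \<and> card S = d + 1}"
  have gp: "eventually (\<lambda>\<delta>. \<forall>S\<in>SS. \<not> cohyp \<delta> S) (at_right 0)"
  proof (rule eventually_ball_finite[OF _ ballI])
    show "finite SS"
      unfolding SS_def using I by (auto intro: rev_finite_subset[of "Pow I"])
    fix S assume "S \<in> SS"
    then have S: "S \<subseteq> I" "card S = d + 1" by (auto simp: SS_def)
    have "\<exists>p\<in>S. dot d a (\<mu> p) \<noteq> b" if a: "\<exists>i<d. a i \<noteq> 0" for a b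
    proof (rule ccontr)
      assume "\<not> ?thesis"
      moreover have "\<mu> ` S \<subseteq> P" using \<mu> S by (auto simp: bij_betw_def)
      ultimately have "\<mu> ` S \<subseteq> {x \<in> Rn d. (\<Sum>i<d. a i * x i) = b}"
        using P(1) by (auto simp: general_position_def dot_def)
      moreover have "hyperplane d {x \<in> Rn d. (\<Sum>i<d. a i * x i) = b}"
        using a unfolding hyperplane_def by blast
      moreover have "card (\<mu> ` S) = d + 1"
        using S \<mu> by (metis bij_betw_def card_image inj_on_subset)
      ultimately show False using P(1) \<open>\<mu> ` S \<subseteq> P\<close> unfolding general_position_def by blast
    qed
    from on_hyperplane_finite_parameters[OF S(2) d this, of f'] have fin:
      "finite {s. \<exists>a b. (\<exists>i<d. a i \<noteq> 0) \<and> (\<forall>p\<in>S. dot d a (\<mu> p + s *\<^sub>R f' p) = b)}" (is "finite ?X")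
      by blast
    have bad: "\<delta> \<in> inverse ` ?X" if "\<delta> > 0" "cohyp \<delta> S" for \<delta>
    proof -
      obtain a b where ab: "\<exists>i<d. a i \<noteq> 0" "\<forall>p\<in>S. dot d a (g \<delta> p) = b" using \<open>cohyp \<delta> S\<close> unfolding cohyp_def by blast
      have "dot d a (\<mu> p + inverse \<delta> *\<^sub>R f' p) = inverse \<delta> * b" if "p \<in> S" for p
      proof -
        have "dot d a (g \<delta> p) = b" using ab that by blast
        then show ?thesis using \<open>\<delta> > 0\<close> by (simp add: g_def field_simps)
      qed
      then have "inverse \<delta> \<in> ?X" using ab by blast
      then have "inverse (inverse \<delta>) \<in> inverse ` ?X" by (rule imageI)
      then show ?thesis by (simp only: inverse_inverse_eq)
    qed
    have "eventually (\<lambda>\<delta>. \<delta> \<notin> inverse ` ?X) (at_right 0)"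
      using fin by (intro eventually_avoids_finite finite_imageI)
    then show "eventually (\<lambda>\<delta>. \<not> cohyp \<delta> S) (at_right 0)"
      using eventually_at_right_less[of "0::real"] by eventually_elim (use bad in blast)
  qed
  obtain \<delta> where \<delta>: "\<forall>Q\<in>Pow I. \<forall>p\<in>Q. hidden d f Q p \<longrightarrow> hidden d (g \<delta>) Q p"
    "\<forall>p\<in>I. \<forall>q\<in>I. p \<noteq> q \<longrightarrow> g \<delta> p \<noteq> g \<delta> q"
    "\<forall>S\<in>SS. \<not> cohyp \<delta> S"
    using eventually_happens'[OF trivial_limit_at_right_real eventually_conj[OF hid eventually_conj[OF inj gp]]]
    by blast
  have inj: "inj_on (g \<delta>) I" using \<delta>(2) by (auto intro: inj_onI)
  have "general_position d (g \<delta> ` I)"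
    unfolding general_position_def
  proof (intro conjI notI)
    assume "\<exists>S H. S \<subseteq> g \<delta> ` I \<and> card S = d + 1 \<and> hyperplane d H \<and> S \<subseteq> H"
    then obtain S' H where S': "S' \<subseteq> g \<delta> ` I" "card S' = d + 1" "hyperplane d H" "S' \<subseteq> H" by blast
    then obtain S where S: "S \<subseteq> I" "S' = g \<delta> ` S" by (meson subset_imageE)
    have "card S = d + 1" using S S'(2) inj by (metis card_image inj_on_subset)
    moreover obtain a b where ab: "\<exists>i<d. a i \<noteq> 0" "H = {x \<in> Rn d. (\<Sum>i<d. a i * x i) = b}"
      using S'(3) unfolding hyperplane_def by blast
    have "dot d a (g \<delta> p) = b" if "p \<in> S" for p
    proof -
      have "g \<delta> p \<in> H" using that S(2) S'(4) by blast
      then show ?thesis by (simp add: ab(2) dot_def)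
    qed
    then have "cohyp \<delta> S" unfolding cohyp_def using ab(1) by blast
    ultimately show False using \<delta>(3) S(1) by (simp add: SS_def)
  qed (use I gRn in auto)
  then show ?thesis using that[of "g \<delta>"] inj \<delta>(1) by blast
qed

section \<open>Potentials that dominate the number of peelings\<close>

text \<open>
  The last clause lets \<open>B Q\<close> bound the number of peelings of \<open>Q\<close>, by induction on \<open>Q\<close>.
  The middle clause is a decay which peeling numbers themselves need not have; it makes the weights
  balance when arms are merged. All subsets are included, so that nothing has to be said about which
  of them occur during a peeling.
\<close>

definition potential :: "real \<Rightarrow> ('p set \<Rightarrow> 'p \<Rightarrow> bool) \<Rightarrow> 'p set \<Rightarrow> ('p set \<Rightarrow> real) \<Rightarrow> bool"
  where "potential \<gamma> hid I B \<longleftrightarrow> B {} = 1 \<and>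
    (\<forall>Q\<subseteq>I. \<forall>p\<in>Q. \<gamma> * B (Q - {p}) \<le> B Q) \<and>
    (\<forall>Q\<subseteq>I. (\<Sum>p | p \<in> Q \<and> \<not> hid Q p. B (Q - {p})) \<le> B Q)"

lemma potential_pos:
  assumes "potential \<gamma> hid I B" "finite I" "\<gamma> > 0" "Q \<subseteq> I"
  shows "0 < B Q"
proof -
  have "finite Q" using assms finite_subset by blast
  then show ?thesis using assms(4)
  proof (induction Q rule: finite_induct)
    case empty
    then show ?case using assms(1) by (simp add: potential_def)
  next
    case (insert p Q)
    then have "\<gamma> * B (insert p Q - {p}) \<le> B (insert p Q)"
      using assms(1) unfolding potential_def by blast
    moreover have "insert p Q - {p} = Q" using insert by auto
    ultimately show ?case using insert assms(3) by (metis insert_subset less_le_trans mult_pos_pos)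
  qed
qed

lemma potential_hidden_mono:
  assumes "potential \<gamma> hid I B" "finite I" "\<gamma> > 0"
    and "\<And>Q p. Q \<subseteq> I \<Longrightarrow> p \<in> Q \<Longrightarrow> hid Q p \<Longrightarrow> hid' Q p"
  shows "potential \<gamma> hid' I B"
  unfolding potential_def
proof (intro conjI allI impI)
  fix Q assume Q: "Q \<subseteq> I"
  have "(\<Sum>p | p \<in> Q \<and> \<not> hid' Q p. B (Q - {p})) \<le> (\<Sum>p | p \<in> Q \<and> \<not> hid Q p. B (Q - {p}))"
  proof (rule sum_mono2)
    show "finite {p \<in> Q. \<not> hid Q p}" using Q assms(2) finite_subset by fastforce
    show "{p \<in> Q. \<not> hid' Q p} \<subseteq> {p \<in> Q. \<not> hid Q p}" using assms(4) Q by blast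
    show "0 \<le> B (Q - {p})" for p
      using potential_pos[OF assms(1-3), of "Q - {p}"] Q by (auto intro: less_imp_le)
  qed
  also have "\<dots> \<le> B Q" using assms(1) Q by (simp add: potential_def)
  finally show "(\<Sum>p | p \<in> Q \<and> \<not> hid' Q p. B (Q - {p})) \<le> B Q" .
qed (use assms(1) in \<open>auto simp: potential_def\<close>)

lemma potential_power:
  assumes "finite I" "real (card I) \<le> D" "\<gamma> \<le> D" "0 \<le> D"
  shows "potential \<gamma> hid I (\<lambda>Q. D ^ card Q)"
  unfolding potential_def
proof (intro conjI allI impI ballI)
  fix Q assume Q: "Q \<subseteq> I"
  then have fin: "finite Q" using assms finite_subset by blast
  have cQ: "card Q = Suc (card (Q - {p}))" if "p \<in> Q" for p
    by (rule card.remove[OF fin that])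
  show "\<gamma> * D ^ card (Q - {p}) \<le> D ^ card Q" if "p \<in> Q" for p
    using assms cQ[OF that] by (simp add: mult_right_mono)
  show "(\<Sum>p | p \<in> Q \<and> \<not> hid Q p. D ^ card (Q - {p})) \<le> D ^ card Q"
  proof (cases "Q = {}")
    case False
    have "(\<Sum>p | p \<in> Q \<and> \<not> hid Q p. D ^ card (Q - {p})) \<le> (\<Sum>p\<in>Q. D ^ card (Q - {p}))"
      using fin assms(4) by (intro sum_mono2) auto
    also have "\<dots> = real (card Q) * D ^ (card Q - 1)" using cQ by (simp add: fin)
    also have "\<dots> \<le> D * D ^ (card Q - 1)"
      using card_mono[OF assms(1) Q] assms by (intro mult_right_mono) auto
    also have "\<dots> = D ^ card Q" using False fin by (simp add: power_eq_if)
    finally show ?thesis .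
  qed simp
qed simp

text \<open>
  In the first phase, with more than \<open>k - m\<close> inhabited arms, at most one point per arm can go.
  Summed over the arms, the terms for a fixed set \<open>S\<close> of survivors shrink by
  \<open>1 / ((m + 1)(k - m))\<close> for each of the \<open>k - m\<close> arms in \<open>S\<close> and by \<open>1 / (m + 1)\<close> for each
  of the \<open>m\<close> others, in total by exactly \<open>1\<close>. In the second phase the factor \<open>k - m\<close> per
  point pays for the choice of the arm. When the phases change, the second-phase potential is one of
  the summands of the first.
\<close>

lemma potential_merge:
  fixes c :: "'p \<Rightarrow> nat"
  defines "arm \<equiv> \<lambda>Q i. {p \<in> Q. c p = i}"
  assumes I: "finite I" "c ` I \<subseteq> {..<k}" and m: "m < k"
    and pot: "\<And>i. i < k \<Longrightarrow> potential (real m + 1) (hidi i) (arm I i) (Bi i)"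
    and hid1: "\<And>Q p. Q \<subseteq> I \<Longrightarrow> p \<in> Q \<Longrightarrow> hidi (c p) (arm Q (c p)) p \<Longrightarrow> hid Q p"
    and hid2: "\<And>Q p q. Q \<subseteq> I \<Longrightarrow> k - m < card (c ` Q) \<Longrightarrow> p \<in> Q \<Longrightarrow> q \<in> Q \<Longrightarrow> p \<noteq> q \<Longrightarrow>
      c p = c q \<Longrightarrow> hid Q p \<or> hid Q q"
  shows "\<exists>B. potential (real m + 1) hid I B \<and>
    B I \<le> (\<Sum>S | S \<subseteq> {..<k} \<and> card S = k - m.
      (\<Prod>i\<in>S. Bi i (arm I i) * real (k - m) ^ card (arm I i)) *
      (\<Prod>i\<in>{..<k} - S. (real m + 1) ^ card (arm I i)))"
proof -
  define \<gamma> where "\<gamma> = real m + 1"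
  define w where "w = real (k - m)"
  have w: "1 \<le> w" "0 < w" using m by (auto simp: w_def)
  have g: "0 < \<gamma>" by (simp add: \<gamma>_def)
  define wt where "wt S i A = (if i \<in> S then Bi i A * w ^ card A else \<gamma> ^ card A)" for S i A
  define \<Phi> where "\<Phi> S Q = (\<Prod>i<k. wt S i (arm Q i))" for S Q
  define SS where "SS = {S. S \<subseteq> {..<k} \<and> card S = k - m}"
  have SS: "finite SS" unfolding SS_def by (rule finite_subset[of _ "Pow {..<k}"]) auto
  have fin: "finite Q" if "Q \<subseteq> I" for Q using that I finite_subset by blast
  have sub: "arm Q i \<subseteq> arm I i" if "Q \<subseteq> I" for Q i using that by (auto simp: arm_def)
  have finarm: "finite (arm Q i)" if "Q \<subseteq> I" for Q i using fin[OF that] by (simp add: arm_def)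
  have c_less: "c p < k" if "Q \<subseteq> I" "p \<in> Q" for p Q using that I by auto
  have Bpos: "0 < Bi i A" if "i < k" "A \<subseteq> arm I i" for i A
    using potential_pos[OF pot[OF that(1)], of A] that finarm[of I] by simp
  have wt_pos: "0 < wt S i A" if "i < k" "A \<subseteq> arm I i" for S i A
    using Bpos[OF that] w g by (simp add: wt_def)
  have \<Phi>_pos: "0 < \<Phi> S Q" if "Q \<subseteq> I" for S Q
    unfolding \<Phi>_def using sub[OF that] by (intro prod_pos) (auto intro: wt_pos)
  have card_arm: "card (arm Q (c p)) = Suc (card (arm Q (c p) - {p}))" if "Q \<subseteq> I" "p \<in> Q" for Q p
  proof -
    have "p \<in> arm Q (c p)" using that by (simp add: arm_def)
    then show ?thesis by (rule card.remove[OF finarm[OF that(1)]])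
  qed
  (* Deleting a point changes only the factor of its arm. *)
  have \<Phi>_remove: "\<Phi> S (Q - {p}) = wt S (c p) (arm Q (c p) - {p}) * (\<Phi> S Q / wt S (c p) (arm Q (c p)))"
    if "Q \<subseteq> I" "p \<in> Q" for S Q p
  proof -
    have "arm (Q - {p}) (c p) = arm Q (c p) - {p}" by (auto simp: arm_def)
    moreover have "arm (Q - {p}) i = arm Q i" if "i \<noteq> c p" for i
      using that by (auto simp: arm_def)
    ultimately have "\<Phi> S (Q - {p}) = wt S (c p) (arm Q (c p) - {p}) * (\<Prod>i\<in>{..<k} - {c p}. wt S i (arm Q i))"
      unfolding \<Phi>_def using c_less[OF that] by (subst prod.remove[of _ "c p"]) auto
    moreover have "\<Phi> S Q = wt S (c p) (arm Q (c p)) * (\<Prod>i\<in>{..<k} - {c p}. wt S i (arm Q i))"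
      unfolding \<Phi>_def using c_less[OF that] by (subst prod.remove[of _ "c p"]) auto
    moreover have "wt S (c p) (arm Q (c p)) \<noteq> 0"
      using wt_pos[OF c_less[OF that] sub[OF that(1)], of S] by simp
    ultimately show ?thesis by simp
  qed
  have decay: "\<Phi> S (Q - {p}) \<le> (if c p \<in> S then 1 / (\<gamma> * w) else 1 / \<gamma>) * \<Phi> S Q"
    if Q: "Q \<subseteq> I" "p \<in> Q" for S Q p
  proof -
    have A: "p \<in> arm Q (c p)" using Q by (simp add: arm_def)
    have "wt S (c p) (arm Q (c p) - {p}) \<le> (if c p \<in> S then 1 / (\<gamma> * w) else 1 / \<gamma>) * wt S (c p) (arm Q (c p))"
    proof (cases "c p \<in> S")
      case True
      have "\<gamma> * Bi (c p) (arm Q (c p) - {p}) \<le> Bi (c p) (arm Q (c p))"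
        using pot[OF c_less[OF Q]] sub[OF Q(1), of "c p"] A unfolding potential_def \<gamma>_def by blast
      then show ?thesis using True w g
        by (simp add: wt_def card_arm[OF Q] field_simps)
    next
      case False
      then show ?thesis using g by (simp add: wt_def card_arm[OF Q])
    qed
    then have "\<Phi> S (Q - {p}) \<le> (if c p \<in> S then 1 / (\<gamma> * w) else 1 / \<gamma>) * wt S (c p) (arm Q (c p)) *
        (\<Phi> S Q / wt S (c p) (arm Q (c p)))"
      unfolding \<Phi>_remove[OF Q] using \<Phi>_pos[OF Q(1), of S] wt_pos[OF c_less[OF Q] sub[OF Q(1)], of S]
      by (intro mult_right_mono) auto
    also have "\<dots> = (if c p \<in> S then 1 / (\<gamma> * w) else 1 / \<gamma>) * \<Phi> S Q"
      using wt_pos[OF c_less[OF Q] sub[OF Q(1)], of S] by simp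
    finally show ?thesis .
  qed
  have decay': "\<gamma> * \<Phi> S (Q - {p}) \<le> \<Phi> S Q" if Q: "Q \<subseteq> I" "p \<in> Q" for S Q p
  proof -
    have "(if c p \<in> S then 1 / (\<gamma> * w) else 1 / \<gamma>) \<le> 1 / \<gamma>"
      using w g by (auto simp: field_simps)
    then have "\<Phi> S (Q - {p}) \<le> 1 / \<gamma> * \<Phi> S Q"
      using decay[OF Q, of S] \<Phi>_pos[OF Q(1), of S]
      by (meson less_imp_le mult_right_mono order_trans)
    then show ?thesis using g by (simp add: field_simps)
  qed
  define B where "B Q = (if k - m < card (c ` Q) then (\<Sum>S\<in>SS. \<Phi> S Q) else \<Phi> {..<k} Q)" for Q
  have late: "\<Phi> {..<k} Q \<le> (\<Sum>S\<in>SS. \<Phi> S Q)" if Q: "Q \<subseteq> I" "card (c ` Q) \<le> k - m" for Q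
  proof -
    have "c ` Q \<subseteq> {..<k}" using Q I by auto
    then obtain S where S: "c ` Q \<subseteq> S" "S \<subseteq> {..<k}" "card S = k - m"
      using Q(2) exists_subset_between[of "c ` Q" "k - m" "{..<k}"] by auto
    have "wt {..<k} i (arm Q i) = wt S i (arm Q i)" if "i < k" for i
    proof (cases "i \<in> S")
      case False
      then have "arm Q i = {}" using S by (auto simp: arm_def)
      moreover have "Bi i {} = 1" using pot[OF that] by (simp add: potential_def)
      ultimately show ?thesis using False that by (simp add: wt_def)
    qed (use that in \<open>simp add: wt_def\<close>)
    then have "\<Phi> {..<k} Q = \<Phi> S Q" by (simp add: \<Phi>_def)
    also have "\<dots> \<le> (\<Sum>S\<in>SS. \<Phi> S Q)"
      using S SS \<Phi>_pos[OF Q(1)] by (intro member_le_sum) (auto simp: SS_def less_imp_le)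
    finally show ?thesis .
  qed
  have B_le: "B Q \<le> (\<Sum>S\<in>SS. \<Phi> S Q)" if "Q \<subseteq> I" for Q
    using late[OF that] by (simp add: B_def)
  have "potential \<gamma> hid I B"
    unfolding potential_def
  proof (intro conjI allI impI ballI)
    have "wt {..<k} i (arm {} i) = 1" if "i < k" for i
      using pot[OF that] that by (simp add: potential_def wt_def arm_def)
    then show "B {} = 1" by (simp add: B_def \<Phi>_def)
  next
    fix Q p assume Q: "Q \<subseteq> I" "p \<in> Q"
    have Q': "Q - {p} \<subseteq> I" using Q by blast
    show "\<gamma> * B (Q - {p}) \<le> B Q"
    proof (cases "k - m < card (c ` Q)")
      case True
      have "\<gamma> * B (Q - {p}) \<le> (\<Sum>S\<in>SS. \<gamma> * \<Phi> S (Q - {p}))"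
        using B_le[OF Q'] g by (simp flip: sum_distrib_left)
      also have "\<dots> \<le> (\<Sum>S\<in>SS. \<Phi> S Q)" using decay'[OF Q] by (intro sum_mono) simp
      finally show ?thesis using True by (simp add: B_def)
    next
      case False
      have "card (c ` (Q - {p})) \<le> card (c ` Q)"
        using fin[OF Q(1)] by (intro card_mono) auto
      then have "B (Q - {p}) = \<Phi> {..<k} (Q - {p})" using False by (simp add: B_def)
      then show ?thesis using decay'[OF Q] False by (simp add: B_def)
    qed
  next
    fix Q assume Q: "Q \<subseteq> I"
    let ?N = "{p \<in> Q. \<not> hid Q p}"
    have N: "finite ?N" using fin[OF Q] by simp
    show "(\<Sum>p | p \<in> Q \<and> \<not> hid Q p. B (Q - {p})) \<le> B Q"
    proof (cases "k - m < card (c ` Q)")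
      case True
      have inj: "inj_on c ?N" using hid2[OF Q True] by (auto intro!: inj_onI)
      have cN: "c ` ?N \<subseteq> {..<k}" using Q I by auto
      have "(\<Sum>p\<in>?N. B (Q - {p})) \<le> (\<Sum>p\<in>?N. \<Sum>S\<in>SS. \<Phi> S (Q - {p}))"
        using Q by (intro sum_mono B_le) auto
      also have "\<dots> = (\<Sum>S\<in>SS. \<Sum>p\<in>?N. \<Phi> S (Q - {p}))" by (rule sum.swap)
      also have "\<dots> \<le> (\<Sum>S\<in>SS. \<Phi> S Q)"
      proof (rule sum_mono)
        fix S assume "S \<in> SS"
        then have S: "S \<subseteq> {..<k}" "card S = k - m" by (auto simp: SS_def)
        let ?f = "\<lambda>i. if i \<in> S then 1 / (\<gamma> * w) else 1 / \<gamma>"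
        have "(\<Sum>p\<in>?N. \<Phi> S (Q - {p})) \<le> (\<Sum>p\<in>?N. ?f (c p) * \<Phi> S Q)"
          using decay[OF Q] by (intro sum_mono) auto
        also have "\<dots> = (\<Sum>i\<in>c ` ?N. ?f i) * \<Phi> S Q"
          using inj by (simp add: sum.reindex sum_distrib_right)
        also have "\<dots> \<le> (\<Sum>i<k. ?f i) * \<Phi> S Q"
          using cN \<Phi>_pos[OF Q, of S] w g by (intro mult_right_mono sum_mono2) auto
        also have "(\<Sum>i<k. ?f i) = (\<Sum>i\<in>S. ?f i) + (\<Sum>i\<in>{..<k} - S. ?f i)"
          using S by (simp add: sum.subset_diff)
        also have "\<dots> = real (k - m) / (\<gamma> * w) + real m / \<gamma>"
          using S m finite_subset[OF S(1)] by (simp add: card_Diff_subset)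
        also have "real (k - m) / (\<gamma> * w) = 1 / \<gamma>"
          unfolding w_def[symmetric] using w by simp
        also have "1 / \<gamma> + real m / \<gamma> = 1"
          using g unfolding add_divide_distrib[symmetric] by (simp add: \<gamma>_def)
        finally show "(\<Sum>p\<in>?N. \<Phi> S (Q - {p})) \<le> \<Phi> S Q" by simp
      qed
      finally show ?thesis using True by (simp add: B_def)
    next
      case False
      let ?W = "\<lambda>i. wt {..<k} i (arm Q i)"
      have W: "0 < ?W i" if "i < k" for i using wt_pos[OF that sub[OF Q]] .
      have cQ: "finite (c ` Q)" "c ` Q \<subseteq> {..<k}" using Q I fin[OF Q] by auto
      have "B (Q - {p}) = \<Phi> {..<k} (Q - {p})" for p
      proof -
        have "card (c ` (Q - {p})) \<le> card (c ` Q)" using fin[OF Q] by (intro card_mono) auto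
        then show ?thesis using False by (simp add: B_def)
      qed
      then have "(\<Sum>p\<in>?N. B (Q - {p})) = (\<Sum>p\<in>?N. wt {..<k} (c p) (arm Q (c p) - {p}) * (\<Phi> {..<k} Q / ?W (c p)))"
        using \<Phi>_remove[OF Q] by (intro sum.cong) auto
      also have "\<dots> = (\<Sum>i\<in>c ` Q. \<Sum>p\<in>{p \<in> ?N. c p = i}. wt {..<k} (c p) (arm Q (c p) - {p}) * (\<Phi> {..<k} Q / ?W (c p)))"
        using N cQ by (intro sum.group[symmetric]) auto
      also have "\<dots> \<le> (\<Sum>i\<in>c ` Q. \<Phi> {..<k} Q / w)"
      proof (rule sum_mono)
        fix i assume "i \<in> c ` Q"
        then have i: "i < k" "arm Q i \<noteq> {}" using cQ by (auto simp: arm_def)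
        let ?A = "arm Q i"
        let ?M = "{p \<in> ?A. \<not> hidi i ?A p}"
        have A: "?A \<subseteq> arm I i" by (rule sub[OF Q])
        have R: "0 < \<Phi> {..<k} Q / ?W i" using \<Phi>_pos[OF Q] W[OF i(1)] by simp
        have one: "wt {..<k} i (?A - {p}) = Bi i (?A - {p}) * (w ^ card ?A / w)" if "p \<in> ?A" for p
        proof -
          have "card ?A = Suc (card (?A - {p}))" by (rule card.remove[OF finarm[OF Q] that])
          then show ?thesis using i w by (simp add: wt_def)
        qed
        have "(\<Sum>p\<in>{p \<in> ?N. c p = i}. wt {..<k} (c p) (arm Q (c p) - {p}) * (\<Phi> {..<k} Q / ?W (c p)))
            = (\<Sum>p\<in>{p \<in> ?N. c p = i}. wt {..<k} i (?A - {p}) * (\<Phi> {..<k} Q / ?W i))"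
          by (intro sum.cong) auto
        also have "\<dots> \<le> (\<Sum>p\<in>?M. wt {..<k} i (?A - {p}) * (\<Phi> {..<k} Q / ?W i))"
        proof (rule sum_mono2)
          show "finite ?M" using finarm[OF Q] by simp
          show "{p \<in> ?N. c p = i} \<subseteq> ?M" using hid1[OF Q] by (auto simp: arm_def)
          have "?A - {p} \<subseteq> arm I i" for p using A by blast
          then show "0 \<le> wt {..<k} i (?A - {p}) * (\<Phi> {..<k} Q / ?W i)" for p
            by (intro mult_nonneg_nonneg less_imp_le[OF R] less_imp_le[OF wt_pos[OF i(1)]])
        qed
        also have "\<dots> = (\<Sum>p\<in>?M. Bi i (?A - {p}) * (w ^ card ?A / w) * (\<Phi> {..<k} Q / ?W i))"
          by (intro sum.cong) (auto simp: one)
        also have "\<dots> = (\<Sum>p\<in>?M. Bi i (?A - {p})) * (w ^ card ?A / w) * (\<Phi> {..<k} Q / ?W i)"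
          by (simp only: sum_distrib_right)
        also have "\<dots> \<le> Bi i ?A * (w ^ card ?A / w) * (\<Phi> {..<k} Q / ?W i)"
          using pot[OF i(1)] A R w unfolding potential_def by (intro mult_right_mono) auto
        also have "\<dots> = ?W i / w * (\<Phi> {..<k} Q / ?W i)" using i by (simp add: wt_def)
        also have "\<dots> = \<Phi> {..<k} Q / w" using W[OF i(1)] by simp
        finally show "(\<Sum>p\<in>{p \<in> ?N. c p = i}. wt {..<k} (c p) (arm Q (c p) - {p}) * (\<Phi> {..<k} Q / ?W (c p)))
            \<le> \<Phi> {..<k} Q / w" .
      qed
      also have "\<dots> = real (card (c ` Q)) / w * \<Phi> {..<k} Q" by simp
      also have "\<dots> \<le> 1 * \<Phi> {..<k} Q"
        using False w \<Phi>_pos[OF Q, of "{..<k}"] by (intro mult_right_mono) (auto simp: w_def)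
      finally show ?thesis using False by (simp add: B_def)
    qed
  qed
  moreover have "\<Phi> S I = (\<Prod>i\<in>S. Bi i (arm I i) * w ^ card (arm I i)) * (\<Prod>i\<in>{..<k} - S. \<gamma> ^ card (arm I i))"
    if "S \<subseteq> {..<k}" for S
  proof -
    have "\<Phi> S I = (\<Prod>i\<in>{..<k} - S. wt S i (arm I i)) * (\<Prod>i\<in>S. wt S i (arm I i))"
      unfolding \<Phi>_def using that by (intro prod.subset_diff) auto
    then show ?thesis by (simp add: wt_def mult.commute)
  qed
  then have "(\<Sum>S\<in>SS. \<Phi> S I) = (\<Sum>S\<in>SS. (\<Prod>i\<in>S. Bi i (arm I i) * w ^ card (arm I i)) * (\<Prod>i\<in>{..<k} - S. \<gamma> ^ card (arm I i)))"
    by (intro sum.cong) (auto simp: SS_def)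
  ultimately show ?thesis
    using B_le[of I] unfolding SS_def w_def \<gamma>_def by auto
qed

section \<open>Neighbourly directions on the moment curve\<close>

text \<open>
  The left-hand side is, up to sign, the \<open>K\<close>-th finite difference of a polynomial of degree below
  \<open>K\<close>.
\<close>

lemma alternating_binomial_sum_poly:
  fixes p :: "real poly"
  assumes "degree p < K"
  shows "(\<Sum>i\<le>K. (-1) ^ i * real (K choose i) * poly p (real i)) = 0"
  using assms
proof (induction K arbitrary: p)
  case 0
  then show ?case by simp
next
  case (Suc K)
  define q where "q = p - p \<circ>\<^sub>p [:1, 1:]"
  have q: "poly q (real i) = poly p (real i) - poly p (real (Suc i))" for i
    by (simp add: q_def poly_pcompose add.commute)
  have "(\<Sum>i\<le>Suc K. (-1) ^ i * real (Suc K choose i) * poly p (real i))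
      = poly p 0 + (\<Sum>i\<le>K. (-1) ^ Suc i * real (Suc K choose Suc i) * poly p (real (Suc i)))"
    by (subst sum.atMost_Suc_shift) simp
  also have "\<dots> = poly p 0 + (\<Sum>i\<le>K. (-1) ^ Suc i * real (K choose Suc i) * poly p (real (Suc i)))
      - (\<Sum>i\<le>K. (-1) ^ i * real (K choose i) * poly p (real (Suc i)))"
    unfolding binomial_Suc_Suc of_nat_add by (simp add: ring_distribs sum.distrib sum_negf sum_subtractf)
  also have "poly p 0 + (\<Sum>i\<le>K. (-1) ^ Suc i * real (K choose Suc i) * poly p (real (Suc i)))
      = (\<Sum>i\<le>Suc K. (-1) ^ i * real (K choose i) * poly p (real i))"
    by (subst sum.atMost_Suc_shift) simp
  also have "\<dots> = (\<Sum>i\<le>K. (-1) ^ i * real (K choose i) * poly p (real i))"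
    by (simp add: binomial_eq_0)
  finally have eq: "(\<Sum>i\<le>Suc K. (-1) ^ i * real (Suc K choose i) * poly p (real i))
      = (\<Sum>i\<le>K. (-1) ^ i * real (K choose i) * poly q (real i))"
    by (simp add: q algebra_simps sum_subtractf)
  show ?case
  proof (cases "degree p = 0")
    case True
    then have "q = 0" by (auto simp: q_def elim!: degree_eq_zeroE)
    then show ?thesis using eq by simp
  next
    case False
    have "degree q < degree p"
    proof -
      have deg: "degree (p \<circ>\<^sub>p [:1, 1:]) = degree p" by (simp add: degree_pcompose)
      have "coeff (p \<circ>\<^sub>p [:1, 1:]) (degree p) = lead_coeff p"
        using lead_coeff_comp[of "[:1, 1 :: real:]" p] deg by simp
      then have "coeff q (degree p) = 0" by (simp add: q_def)
      moreover have "degree q \<le> degree p"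
        unfolding q_def using deg degree_diff_le_max[of p "p \<circ>\<^sub>p [:1, 1:]"] by simp
      ultimately show ?thesis
        using False by (metis eq_zero_or_degree_less degree_0 neq0_conv le_neq_implies_less leading_coeff_0_iff)
    qed
    then show ?thesis using eq Suc.IH[of q] Suc.prems by simp
  qed
qed

text \<open>
  Suppose that the set \<open>G\<close> of good indices has fewer than \<open>m\<close> elements. Multiplying \<open>p\<close> by
  quadratics that are negative at exactly one integer reverses the sign at the indices in \<open>G\<close>
  only. The product has degree below \<open>d + 2m - 2\<close> and weakly alternating signs at \<open>d + 2m - 1\<close>
  consecutive integers, so all terms of its vanishing alternating binomial sum are zero, which gives
  it too many roots.
\<close>

lemma gale_polynomial:
  fixes p :: "real poly"
  assumes p: "p \<noteq> 0" "degree p < d" and m: "m \<ge> 1"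
  shows "m \<le> card {i. i < d + 2 * m - 1 \<and> 0 < (-1) ^ i * poly p (real i)}"
proof (rule ccontr)
  let ?k = "d + 2 * m - 1"
  define G where "G = {i. i < ?k \<and> 0 < (-1) ^ i * poly p (real i)}"
  assume "\<not> ?thesis"
  then have G: "finite G" "card G < m" by (auto simp: G_def)
  (* Among the integers, f g is negative at g only. *)
  define f :: "nat \<Rightarrow> real poly" where "f g = [:- real g, 1:] ^ 2 - [:1 / 4:]" for g
  have f: "poly (f g) (real i) = (real i - real g)\<^sup>2 - 1 / 4" for g i
    by (simp add: f_def)
  have f_pos: "0 < poly (f g) (real i)" if "g \<noteq> i" for g i
  proof -
    have "1 \<le> \<bar>real i - real g\<bar>" using that by linarith
    then have "1\<^sup>2 \<le> (real i - real g)\<^sup>2" using abs_le_square_iff[of 1 "real i - real g"] by simp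
    then show ?thesis by (simp add: f)
  qed
  have f_neg: "poly (f g) (real g) < 0" for g by (simp add: f)
  have f_deg: "degree (f g) \<le> 2" "f g \<noteq> 0" for g
    using f_neg[of g] by (auto simp: f_def power2_eq_square)
  define q where "q = p * (\<Prod>g\<in>G. f g)"
  have "q \<noteq> 0" using p f_deg G by (simp add: q_def)
  have "degree (\<Prod>g\<in>G. f g) \<le> 2 * card G"
    using degree_prod_sum_le[OF G(1), of f] sum_mono[of G "degree \<circ> f" "\<lambda>_. 2"] f_deg by simp
  then have "degree q < ?k - 1"
    using degree_mult_le[of p "\<Prod>g\<in>G. f g"] p G m unfolding q_def by linarith
  then have zero: "(\<Sum>i\<le>?k - 1. (-1) ^ i * real ((?k - 1) choose i) * poly q (real i)) = 0"
    by (rule alternating_binomial_sum_poly)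
  have sign: "(-1) ^ i * poly q (real i) \<le> 0" if "i < ?k" for i
  proof (cases "i \<in> G")
    case True
    have "poly q (real i) = poly p (real i) * (poly (f i) (real i) * (\<Prod>g\<in>G - {i}. poly (f g) (real i)))"
      using True G by (simp add: q_def poly_prod prod.remove)
    moreover have "0 < (\<Prod>g\<in>G - {i}. poly (f g) (real i))" by (intro prod_pos) (auto simp: f_pos)
    then have "poly (f i) (real i) * (\<Prod>g\<in>G - {i}. poly (f g) (real i)) < 0"
      using f_neg by (simp add: mult_neg_pos)
    moreover have "0 < (-1) ^ i * poly p (real i)" using True by (simp add: G_def)
    ultimately show ?thesis using mult_pos_neg by (fastforce simp flip: mult.assoc)
  next
    case False
    then have "(-1) ^ i * poly p (real i) \<le> 0" using that by (simp add: G_def)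
    moreover have "0 < (\<Prod>g\<in>G. poly (f g) (real i))" using False by (intro prod_pos) (metis f_pos)
    moreover have "(-1) ^ i * poly q (real i) = ((-1) ^ i * poly p (real i)) * (\<Prod>g\<in>G. poly (f g) (real i))"
      by (simp add: q_def poly_prod)
    ultimately show ?thesis by (simp only: mult_nonpos_nonneg less_imp_le)
  qed
  have root: "poly q (real i) = 0" if "i < ?k" for i
  proof -
    have "\<forall>i\<in>{..?k - 1}. - ((-1) ^ i * real ((?k - 1) choose i) * poly q (real i)) = 0"
    proof (subst sum_nonneg_eq_0_iff[symmetric])
      fix i assume "i \<in> {..?k - 1}"
      then have "i < ?k" using p m by auto
      then have "(-1) ^ i * poly q (real i) \<le> 0" by (rule sign)
      then have "real ((?k - 1) choose i) * ((-1) ^ i * poly q (real i)) \<le> 0"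
        by (simp add: mult_nonneg_nonpos)
      then show "0 \<le> - ((-1) ^ i * real ((?k - 1) choose i) * poly q (real i))"
        by (simp add: mult_ac)
    qed (use zero in \<open>simp_all add: sum_negf\<close>)
    moreover have i: "i \<in> {..?k - 1}" using that by simp
    ultimately have "- ((-1) ^ i * real ((?k - 1) choose i) * poly q (real i)) = 0" by (rule bspec)
    moreover have "real ((?k - 1) choose i) \<noteq> 0" using i by (simp add: binomial_eq_0_iff)
    ultimately show ?thesis by simp
  qed
  have "real ` {..<?k} \<subseteq> {x. poly q x = 0}" using root by auto
  then have "card (real ` {..<?k}) \<le> card {x. poly q x = 0}"
    using poly_roots_finite[OF \<open>q \<noteq> 0\<close>] by (intro card_mono) auto
  also have "\<dots> \<le> degree q" using card_poly_roots_bound[OF \<open>q \<noteq> 0\<close>] .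
  finally show False using \<open>degree q < ?k - 1\<close> by (simp add: card_image)
qed

text \<open>
  A functional evaluated on the moment curve is a polynomial of degree below \<open>d\<close>.
\<close>

lemma gale_directions:
  assumes a: "\<exists>j<d. a j \<noteq> 0" and m: "m \<ge> 1"
  shows "m \<le> card {i. i < d + 2 * m - 1 \<and> 0 < dot d a (\<lambda>j. (-1) ^ i * real i ^ j)}"
proof -
  define p where "p = (\<Sum>j<d. monom (a j) j)"
  have coeff: "coeff p j = (if j < d then a j else 0)" for j
    by (simp add: p_def coeff_sum)
  then have "p \<noteq> 0" using a by (metis coeff_0)
  moreover have "degree p < d"
    using a coeff by (metis \<open>p \<noteq> 0\<close> leading_coeff_0_iff)
  moreover have "dot d a (\<lambda>j. (-1) ^ i * real i ^ j) = (-1) ^ i * poly p (real i)" for i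
    by (simp add: dot_def p_def poly_sum poly_monom sum_distrib_left mult_ac)
  ultimately show ?thesis using gale_polynomial[of p d m] m by simp
qed

section \<open>Flattened copies along arms\<close>

text \<open>
  On the moment curve \<open>(1, s, s\<^sup>2, \<dots>)\<close> each vector of \<open>X\<close> excludes only finitely many
  parameters \<open>s\<close>.
\<close>

lemma separating_functional:
  assumes "finite X" "\<forall>x\<in>X. \<exists>i<d. x i \<noteq> 0"
  shows "\<exists>l. \<forall>x\<in>X. dot d l x \<noteq> 0"
proof -
  have "finite {s::real. \<exists>x\<in>X. (\<Sum>i<d. x i * s ^ i) = 0}"
  proof -
    have "finite {s::real. (\<Sum>i<d. x i * s ^ i) = 0}" if x: "x \<in> X" for x
    proof -
      obtain i where i: "i < d" "x i \<noteq> 0" using assms(2) x by blast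
      then have "{..<d} = {..d - 1}" by auto
      then show ?thesis using Transcendental.polyfun_rootbound[of x i "d - 1"] i by simp
    qed
    then have "finite (\<Union>x\<in>X. {s::real. (\<Sum>i<d. x i * s ^ i) = 0})" using assms(1) by blast
    moreover have "{s::real. \<exists>x\<in>X. (\<Sum>i<d. x i * s ^ i) = 0} = (\<Union>x\<in>X. {s::real. (\<Sum>i<d. x i * s ^ i) = 0})"
      by blast
    ultimately show ?thesis by simp
  qed
  then obtain s :: real where "s \<notin> {s. \<exists>x\<in>X. (\<Sum>i<d. x i * s ^ i) = 0}"
    using ex_new_if_finite infinite_UNIV_char_0 by blast
  then show ?thesis
    by (intro exI[of _ "\<lambda>i. s ^ i"]) (auto simp: dot_def mult.commute)
qed

text \<open>
  The point \<open>p\<close> goes to \<open>\<tau> p\<close> times the direction of its arm plus \<open>\<epsilon>\<close> times \<open>h p\<close>, where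
  \<open>\<tau> p\<close> is a constant plus the value of a linear functional at \<open>h p\<close>. On a single arm this is
  an invertible affine map, hence hidden points stay hidden. Because \<open>\<tau>\<close> is injective on arms and
  \<open>\<epsilon>\<close> is tiny, an arm is almost a segment. If the functional \<open>a\<close> is not small on the direction
  of \<open>p\<close>, every point further out on the same arm exceeds \<open>p\<close>. Otherwise, if more than \<open>k - m\<close> arms
  are inhabited, one of them has a direction on which \<open>a\<close> is large, and its points exceed \<open>p\<close>.
\<close>

lemma arms_configuration:
  fixes c :: "'p \<Rightarrow> nat" and h :: "'p \<Rightarrow> nat \<Rightarrow> real"
  assumes I: "finite I" "c ` I \<subseteq> {..<k}" and m: "1 \<le> m" "m \<le> k"
    and dir: "\<And>a. \<exists>i<d. a i \<noteq> 0 \<Longrightarrow> m \<le> card {i. i < k \<and> 0 < dot d a (v i)}"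
    and inj: "\<And>p q. p \<in> I \<Longrightarrow> q \<in> I \<Longrightarrow> c p = c q \<Longrightarrow> p \<noteq> q \<Longrightarrow> \<exists>i<d. h p i \<noteq> h q i"
  shows "\<exists>F. (\<forall>Q\<subseteq>I. \<forall>p\<in>Q. hidden d h {q \<in> Q. c q = c p} p \<longrightarrow> hidden d F Q p) \<and>
    (\<forall>Q\<subseteq>I. k - m < card (c ` Q) \<longrightarrow>
      (\<forall>p\<in>Q. \<forall>q\<in>Q. p \<noteq> q \<and> c p = c q \<longrightarrow> hidden d F Q p \<or> hidden d F Q q))"
proof -
  obtain l where l: "\<And>p q. p \<in> I \<Longrightarrow> q \<in> I \<Longrightarrow> c p = c q \<Longrightarrow> p \<noteq> q \<Longrightarrow> dot d l (h p - h q) \<noteq> 0"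
  proof -
    let ?X = "(\<lambda>(p, q). h p - h q) ` {(p, q). p \<in> I \<and> q \<in> I \<and> c p = c q \<and> p \<noteq> q}"
    have "finite {(p, q). p \<in> I \<and> q \<in> I \<and> c p = c q \<and> p \<noteq> q}"
      using I(1) by (auto intro: rev_finite_subset[of "I \<times> I"])
    then have "finite ?X" by (rule finite_imageI)
    moreover have "\<forall>x\<in>?X. \<exists>i<d. x i \<noteq> 0" using inj by fastforce
    ultimately obtain l where "\<forall>x\<in>?X. dot d l x \<noteq> 0" using separating_functional by blast
    then show thesis by (intro that[of l]) (force simp: image_iff)
  qed
  (* The sign makes the linear part of the map on each arm invertible for every \<epsilon> > 0. *)
  define s where "s i = (if 0 \<le> dot d l (v i) then 1 else - 1 :: real)" for i
  define ht where "ht p = s (c p) * dot d l (h p)" for p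
  have ht: "ht p \<noteq> ht q" if "p \<in> I" "q \<in> I" "c p = c q" "p \<noteq> q" for p q
    using l[OF that] that by (simp add: ht_def s_def)
  define X where "X = 1 + (\<Sum>p\<in>I. \<bar>ht p\<bar>)"
  have X: "1 \<le> X" by (simp add: X_def sum_nonneg)
  have htX: "\<bar>ht p\<bar> \<le> X - 1" if "p \<in> I" for p
    using that I(1) member_le_sum[of p I "\<lambda>p. \<bar>ht p\<bar>"] by (simp add: X_def)
  define \<tau> where "\<tau> p = X + ht p" for p
  have \<tau>: "1 \<le> \<tau> p" "\<tau> p \<le> 2 * X" if "p \<in> I" for p
    using htX[OF that] by (auto simp: \<tau>_def)
  obtain \<eta> where \<eta>: "0 < \<eta>"
    and wide: "\<And>a T. \<exists>i<d. a i \<noteq> 0 \<Longrightarrow> T \<subseteq> {..<k} \<Longrightarrow> k - m < card T \<Longrightarrow>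
      \<exists>i\<in>T. \<eta> * (\<Sum>i<d. \<bar>a i\<bar>) \<le> dot d a (v i)"
  proof -
    define TT where "TT = {T. T \<subseteq> {..<k} \<and> k - m < card T}"
    have fin: "finite TT" unfolding TT_def by (rule finite_subset[of _ "Pow {..<k}"]) auto
    let ?good = "\<lambda>e T. \<forall>a. (\<exists>i<d. a i \<noteq> 0) \<longrightarrow> (\<exists>i\<in>T. e * (\<Sum>i<d. \<bar>a i\<bar>) \<le> dot d a (v i))"
    have "\<exists>e>0. ?good e T" if T: "T \<in> TT" for T
    proof (rule uniform_positive_direction)
      show "finite T" using T finite_subset by (auto simp: TT_def)
      fix a :: "nat \<Rightarrow> real" assume a: "\<exists>i<d. a i \<noteq> 0"
      let ?G = "{i. i < k \<and> 0 < dot d a (v i)}"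
      show "\<exists>i\<in>T. 0 < dot d a (v i)"
      proof (rule ccontr)
        assume "\<not> ?thesis"
        then have "T \<inter> ?G = {}" by auto
        moreover have "T \<union> ?G \<subseteq> {..<k}" using T by (auto simp: TT_def)
        ultimately have "card T + card ?G \<le> k"
          using card_mono[of "{..<k}" "T \<union> ?G"] T finite_subset[of T "{..<k}"]
          by (subst card_Un_disjoint[symmetric]) (auto simp: TT_def)
        moreover have "k - m < card T" using T by (simp add: TT_def)
        ultimately show False using dir[OF a] m(2) by linarith
      qed
    qed
    then have "\<forall>T\<in>TT. \<exists>e. 0 < e \<and> ?good e T" by blast
    from bchoice[OF this] obtain e where e: "\<forall>T\<in>TT. 0 < e T \<and> ?good (e T) T" by blast
    define \<eta> where "\<eta> = Min (insert 1 (e ` TT))"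
    have "0 < \<eta>" unfolding \<eta>_def using fin e by (subst Min_gr_iff) auto
    moreover have "\<exists>i\<in>T. \<eta> * (\<Sum>i<d. \<bar>a i\<bar>) \<le> dot d a (v i)"
      if a: "\<exists>i<d. a i \<noteq> 0" and T: "T \<subseteq> {..<k}" "k - m < card T" for a T
    proof -
      have T': "T \<in> TT" using T by (simp add: TT_def)
      then obtain i where i: "i \<in> T" "e T * (\<Sum>i<d. \<bar>a i\<bar>) \<le> dot d a (v i)" using e a by blast
      have "\<eta> \<le> e T" unfolding \<eta>_def using T' fin by (intro Min_le) auto
      then have "\<eta> * (\<Sum>i<d. \<bar>a i\<bar>) \<le> e T * (\<Sum>i<d. \<bar>a i\<bar>)"
        by (intro mult_right_mono) (auto intro: sum_nonneg)
      then show ?thesis using i by (meson order_trans)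
    qed
    ultimately show thesis by (rule that)
  qed
  define g where "g = Min (insert 1 ((\<lambda>(p, q). \<bar>ht p - ht q\<bar>) ` {(p, q). p \<in> I \<and> q \<in> I \<and> c p = c q \<and> p \<noteq> q}))"
  have finpairs: "finite {(p, q). p \<in> I \<and> q \<in> I \<and> c p = c q \<and> p \<noteq> q}"
    using I(1) by (auto intro: rev_finite_subset[of "I \<times> I"])
  have g: "0 < g" unfolding g_def using finpairs ht by (subst Min_gr_iff) auto
  have gap: "g \<le> \<bar>ht p - ht q\<bar>" if "p \<in> I" "q \<in> I" "c p = c q" "p \<noteq> q" for p q
    unfolding g_def using that finpairs by (intro Min_le) (auto simp: image_iff)
  define M where "M = (\<Sum>p\<in>I. \<Sum>i<d. \<bar>h p i\<bar>)"
  have M0: "0 \<le> M" unfolding M_def by (intro sum_nonneg) auto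
  have M: "\<bar>h p i\<bar> \<le> M" if "p \<in> I" "i < d" for p i
  proof -
    have "\<bar>h p i\<bar> \<le> (\<Sum>i<d. \<bar>h p i\<bar>)" using that by (intro member_le_sum) auto
    also have "\<dots> \<le> M" unfolding M_def using that I
      by (intro member_le_sum[of p I "\<lambda>p. \<Sum>i<d. \<bar>h p i\<bar>"]) (auto intro: sum_nonneg)
    finally show ?thesis .
  qed
  (* The threshold between the two cases: on directions where a is below \<kappa>, scaling by \<tau> \<le> 2 X
  still stays below half of \<eta>. *)
  define \<kappa> where "\<kappa> = \<eta> / (4 * X)"
  have \<kappa>: "0 < \<kappa>" "2 * X * \<kappa> = \<eta> / 2" using \<eta> X by (auto simp: \<kappa>_def)
  define \<epsilon> where "\<epsilon> = min (\<eta> / 2) (g * \<kappa>) / (2 * M + 1)"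
  have \<epsilon>: "0 < \<epsilon>" using \<eta> g \<kappa> M0 by (simp add: \<epsilon>_def)
  have \<epsilon>M: "2 * (\<epsilon> * M) < \<eta> / 2" "2 * (\<epsilon> * M) < g * \<kappa>"
  proof -
    have "\<epsilon> * (2 * M + 1) = min (\<eta> / 2) (g * \<kappa>)" using M0 by (simp add: \<epsilon>_def)
    then have "2 * (\<epsilon> * M) + \<epsilon> = min (\<eta> / 2) (g * \<kappa>)" by (simp add: algebra_simps)
    then show "2 * (\<epsilon> * M) < \<eta> / 2" "2 * (\<epsilon> * M) < g * \<kappa>" using \<epsilon> by linarith+
  qed
  define F where "F p = \<tau> p *\<^sub>R v (c p) + \<epsilon> *\<^sub>R h p" for p
  have dF: "dot d a (F p) = \<tau> p * dot d a (v (c p)) + \<epsilon> * dot d a (h p)" for a p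
    by (simp add: F_def)
  have 1: "hidden d F Q p" if Q: "Q \<subseteq> I" "p \<in> Q" and hid: "hidden d h {q \<in> Q. c q = c p} p" for Q p
    unfolding hidden_def
  proof (intro allI impI)
    fix a :: "nat \<Rightarrow> real" assume a: "\<exists>i<d. a i \<noteq> 0"
    let ?v = "v (c p)" and ?l = "s (c p) *\<^sub>R l"
    (* Up to a constant, a composed with the map on the arm of p is the functional b. *)
    define b where "b = \<epsilon> *\<^sub>R a + dot d a ?v *\<^sub>R ?l"
    have "\<exists>i<d. b i \<noteq> 0"
    proof (rule ccontr)
      assume "\<not> ?thesis"
      then have b0: "dot d b x = 0" for x by (simp add: dot_def)
      have lv: "0 \<le> dot d ?l ?v" by (simp add: s_def)
      have "dot d a ?v * (\<epsilon> + dot d ?l ?v) = dot d b ?v"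
        by (simp add: b_def algebra_simps)
      then have "dot d a ?v * (\<epsilon> + dot d ?l ?v) = 0" using b0 by simp
      moreover have "\<epsilon> + dot d ?l ?v \<noteq> 0" using lv \<epsilon> by linarith
      ultimately have "dot d a ?v = 0" using mult_eq_0_iff by blast
      then have "\<epsilon> * dot d a a = 0" using b0[of a] by (simp add: b_def)
      then show False using \<epsilon> a dot_self_pos by fastforce
    qed
    then obtain q where q: "q \<in> Q" "c q = c p" "dot d b (h p) < dot d b (h q)"
      using hid unfolding hidden_def by blast
    have "dot d a (F r) = X * dot d a ?v + dot d b (h r)" if "c r = c p" for r
      using that by (simp add: dF b_def \<tau>_def ht_def algebra_simps)
    then have "dot d a (F p) < dot d a (F q)" using q by simp
    then show "\<exists>q\<in>Q. dot d a (F p) < dot d a (F q)" using q by blast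
  qed
  have 2: "hidden d F Q p"
    if Q: "Q \<subseteq> I" "k - m < card (c ` Q)" and pq: "p \<in> Q" "q \<in> Q" "p \<noteq> q" "c p = c q"
      and lower: "ht p < ht q" for Q p q
    unfolding hidden_def
  proof (intro allI impI)
    fix a :: "nat \<Rightarrow> real" assume a: "\<exists>i<d. a i \<noteq> 0"
    define N where "N = (\<Sum>i<d. \<bar>a i\<bar>)"
    have N: "0 < N" unfolding N_def using a by (auto intro: sum_pos2)
    have err: "\<bar>\<epsilon> * dot d a (h r)\<bar> \<le> \<epsilon> * M * N" if "r \<in> I" for r
      using abs_dot_le[of d "h r" M a] M[OF that] \<epsilon> by (simp add: abs_mult N_def)
    have pI: "p \<in> I" "q \<in> I" using pq Q by auto
    show "\<exists>q\<in>Q. dot d a (F p) < dot d a (F q)"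
    proof (cases "\<kappa> * N \<le> dot d a (v (c p))")
      case True
      have "g * (\<kappa> * N) \<le> (\<tau> q - \<tau> p) * dot d a (v (c p))"
        using gap[OF pI pq(4,3)] lower True g \<kappa> N by (intro mult_mono) (auto simp: \<tau>_def)
      moreover have "2 * (\<epsilon> * M * N) < g * (\<kappa> * N)"
        using mult_strict_right_mono[OF \<epsilon>M(2) N] by (simp add: mult_ac)
      moreover have "dot d a (F q) - dot d a (F p) =
          (\<tau> q - \<tau> p) * dot d a (v (c p)) + \<epsilon> * dot d a (h q) - \<epsilon> * dot d a (h p)"
        using pq by (simp add: dF algebra_simps)
      ultimately have "dot d a (F p) < dot d a (F q)"
        using err[OF pI(1)] err[OF pI(2)] by linarith
      then show ?thesis using pq by blast
    next
      case False
      have "c ` Q \<subseteq> {..<k}" using Q I by auto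
      from wide[OF a this Q(2)] obtain r where r: "r \<in> Q" "\<eta> * N \<le> dot d a (v (c r))"
        unfolding N_def by blast
      have rI: "r \<in> I" using r Q by blast
      have "1 * (\<eta> * N) \<le> \<tau> r * dot d a (v (c r))"
        using \<tau>(1)[OF rI] r \<eta> N by (intro mult_mono) auto
      moreover have "\<tau> p * dot d a (v (c p)) \<le> \<eta> / 2 * N"
      proof -
        have "\<tau> p * dot d a (v (c p)) \<le> \<tau> p * (\<kappa> * N)"
          using False \<tau>(1)[OF pI(1)] by (intro mult_left_mono) auto
        also have "\<dots> \<le> 2 * X * (\<kappa> * N)"
          using \<tau>(2)[OF pI(1)] \<kappa> N by (intro mult_right_mono) auto
        finally show ?thesis using \<kappa>(2) by (simp flip: mult.assoc)
      qed
      moreover have "2 * (\<epsilon> * M * N) < \<eta> / 2 * N"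
        using mult_strict_right_mono[OF \<epsilon>M(1) N] by (simp add: mult_ac)
      ultimately have "dot d a (F p) < dot d a (F r)"
        using err[OF pI(1)] err[OF rI] unfolding dF by (simp add: abs_le_iff)
      then show ?thesis using r by blast
    qed
  qed
  have 3: "hidden d F Q p \<or> hidden d F Q q"
    if "Q \<subseteq> I" "k - m < card (c ` Q)" "p \<in> Q" "q \<in> Q" "p \<noteq> q \<and> c p = c q" for Q p q
  proof -
    have "ht p \<noteq> ht q" using ht[of p q] that by auto
    then consider "ht p < ht q" | "ht q < ht p" by linarith
    then show ?thesis using 2[of Q p q] 2[of Q q p] that by cases auto
  qed
  show ?thesis
    by (intro exI[of _ F] conjI allI ballI impI) (rule 1 3, assumption+)+
qed

section \<open>Estimates for the recursion\<close>

lemma square_le_two_power: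
  assumes "4 \<le> (L::nat)"
  shows "L\<^sup>2 \<le> 2 ^ L"
  using assms
proof (induction L rule: dec_induct)
  case (step n)
  have "(Suc n)\<^sup>2 \<le> 2 * n\<^sup>2" using step(1)
  proof -
    have "n * 4 \<le> n * n" using step(1) by (intro mult_left_mono) auto
    then have "Suc (n + n) \<le> n * n" using step(1) by linarith
    then show ?thesis by (simp add: power2_eq_square)
  qed
  then show ?case using step by simp
qed simp

text \<open>
  The three ranges of the arm size \<open>N\<close> correspond to the arms being bounded by powers of
  \<open>L\<close>, of \<open>L\<^sup>2 / 2\<close> and of \<open>C\<close>. The factor \<open>2 ^ k\<close> stands for the choice of the
  surviving arms and \<open>L ^ r\<close> for the points left over when \<open>n\<close> is divided by \<open>k\<close>.
\<close>

lemma surplus_absorbed: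
  fixes L k m d N r :: nat
  assumes m: "m \<ge> 1" and d: "d \<ge> 3" and L: "L = d + m" and k: "k = d + 2 * m - 1" and r: "r < k"
  shows "1 \<le> N \<Longrightarrow> (2::real) ^ k * real L ^ r \<le> 4 ^ N * real L ^ ((L - 1) * N + r)"
    and "L \<le> N \<Longrightarrow> (2::real) ^ k * real L ^ r \<le> 4 ^ N * 2 ^ ((L - 1) * N + r)"
    and "L\<^sup>2 < 2 * (N + 1) \<Longrightarrow> (2::real) ^ k * real L ^ r \<le> 4 ^ N"
proof -
  have L4: "4 \<le> L" and kL: "k + 4 \<le> 2 * L" "r + 5 \<le> 2 * L" using m d L k r by auto
  have Lr: "(real L ^ r)\<^sup>2 \<le> 2 ^ (L * r)"
  proof -
    have "(real L)\<^sup>2 \<le> 2 ^ L"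
      using square_le_two_power[OF L4] by (metis of_nat_le_iff of_nat_numeral of_nat_power)
    then have "((real L)\<^sup>2) ^ r \<le> (2 ^ L) ^ r" by (intro power_mono) auto
    then show ?thesis by (simp add: power_mult [symmetric] mult.commute)
  qed
  have sq: "2 ^ k * real L ^ r \<le> (2::real) ^ E" if "2 * k + L * r \<le> 2 * E" for E
  proof (rule power2_le_imp_le)
    have "(2 ^ k * real L ^ r)\<^sup>2 \<le> ((2::real) ^ k)\<^sup>2 * 2 ^ (L * r)"
      unfolding power_mult_distrib using Lr by (intro mult_left_mono) auto
    also have "\<dots> = 2 ^ (2 * k + L * r)" by (simp add: power_add power_mult[symmetric] mult.commute)
    also have "\<dots> \<le> 2 ^ (2 * E)" using that by (intro power_increasing) auto
    also have "\<dots> = (2 ^ E)\<^sup>2" by (simp add: power_mult[symmetric] mult.commute)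
    finally show "(2 ^ k * real L ^ r)\<^sup>2 \<le> ((2::real) ^ E)\<^sup>2" .
  qed simp
  have four: "(4::real) ^ N = 2 ^ (2 * N)" by (simp add: power_mult)
  obtain l where l: "L = l + 4" using L4 by (metis le_add_diff_inverse2)
  show "(2::real) ^ k * real L ^ r \<le> 4 ^ N * real L ^ ((L - 1) * N + r)" if "1 \<le> N"
  proof -
    have "(2::real) ^ k \<le> 2 ^ (2 * (L - 1))" using kL by (intro power_increasing) auto
    also have "\<dots> = 4 ^ (L - 1)" by (simp add: power_mult)
    also have "\<dots> \<le> real L ^ (L - 1)" using L4 by (intro power_mono) auto
    also have "\<dots> \<le> real L ^ ((L - 1) * N)" using L4 that by (intro power_increasing) auto
    also have "\<dots> \<le> 4 ^ N * real L ^ ((L - 1) * N)"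
      using mult_right_mono[of 1 "(4::real) ^ N" "real L ^ ((L - 1) * N)"] by simp
    finally have "2 ^ k * real L ^ r \<le> (4 ^ N * real L ^ ((L - 1) * N)) * real L ^ r"
      by (rule mult_right_mono) simp
    then show ?thesis by (simp add: power_add mult.assoc)
  qed
  show "(2::real) ^ k * real L ^ r \<le> 4 ^ N * 2 ^ ((L - 1) * N + r)" if N: "L \<le> N"
  proof -
    have "(l + 2) * r \<le> (l + 2) * (2 * l + 3)" using kL l by (intro mult_left_mono) auto
    moreover have "(l + 5) * (l + 4) \<le> (l + 5) * N" using N l by (intro mult_left_mono) auto
    moreover have "2 * k \<le> 4 * l + 8" using kL l by simp
    ultimately have "2 * k + (l + 2) * r \<le> 2 * ((l + 5) * N)" by (simp add: algebra_simps)
    then have "2 * k + L * r \<le> 2 * (2 * N + ((L - 1) * N + r))"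
      by (simp add: l algebra_simps)
    from sq[OF this] show ?thesis by (simp add: four power_add)
  qed
  show "(2::real) ^ k * real L ^ r \<le> 4 ^ N" if N: "L\<^sup>2 < 2 * (N + 1)"
  proof -
    have "(l + 4) * r \<le> (l + 4) * (2 * l + 3)" using kL l by (intro mult_left_mono) auto
    moreover have "2 * k \<le> 4 * l + 8" using kL l by simp
    moreover have "l * l + 8 * l + 16 \<le> 2 * N + 1" using N by (simp add: l power2_eq_square algebra_simps)
    ultimately have "2 * k + L * r \<le> 2 * (2 * N)" by (simp add: l algebra_simps)
    from sq[OF this] show ?thesis by (simp add: four)
  qed
qed

text \<open>
  By Bernoulli's inequality both \<open>(L - 1) ^ (L - 1)\<close> and \<open>(m + 1) ^ m\<close> are at most half of the
  corresponding powers of \<open>L\<close>; this is the gain \<open>4 ^ N\<close>. A further gain \<open>q\<close> per point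
  is available if the arms have potential at most \<open>D\<close> per point with \<open>q D \<le> C\<close>.
\<close>

lemma arms_bound_numeric:
  fixes C D q :: real and L k m d N r :: nat
  assumes m: "m \<ge> 1" and d: "d \<ge> 3" and L: "L = d + m" and k: "k = d + 2 * m - 1"
    and C: "C ^ m = real L ^ k" and D: "0 < D" "0 < q" "q * D \<le> C"
    and surplus: "2 ^ k * real L ^ r \<le> 4 ^ N * q ^ ((L - 1) * N + r)"
  shows "2 ^ k * ((D * real (L - 1)) ^ ((L - 1) * N + r) * (real m + 1) ^ (m * N)) \<le> C ^ (k * N + r)"
proof -
  let ?e = "(L - 1) * N + r"
  have L3: "L - 1 \<ge> 1" "L \<ge> 4" using m d L by auto
  have k': "k = (L - 1) + m" using m d L k by auto
  have C0: "0 < C" using D by (meson less_le_trans mult_pos_pos)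
  have one: "2 * real (L - 1) ^ (L - 1) \<le> real L ^ (L - 1)"
  proof -
    have "2 \<le> (1 + 1 / real (L - 1)) ^ (L - 1)"
      using Bernoulli_inequality[of "1 / real (L - 1)" "L - 1"] L3
      by (simp add: order_trans[of "- 1" 0] del: of_nat_diff)
    also have "1 + 1 / real (L - 1) = real L / real (L - 1)" using L3 by (simp add: field_simps of_nat_diff)
    finally show ?thesis using L3 by (simp add: power_divide pos_le_divide_eq)
  qed
  have two: "2 * (real m + 1) ^ m \<le> real L ^ m"
  proof -
    have "2 \<le> 1 + real m * (2 / (real m + 1))" using m by (simp add: field_simps)
    also have "\<dots> \<le> (1 + 2 / (real m + 1)) ^ m"
      by (rule Bernoulli_inequality) (simp add: order_trans[of "- 1" 0])
    also have "1 + 2 / (real m + 1) = (real m + 3) / (real m + 1)" by (simp add: field_simps)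
    finally have "2 * (real m + 1) ^ m \<le> (real m + 3) ^ m"
      by (simp add: power_divide pos_le_divide_eq)
    also have "\<dots> \<le> real L ^ m" using L d by (intro power_mono) auto
    finally show ?thesis .
  qed
  have "(2 * real (L - 1) ^ (L - 1)) * (2 * (real m + 1) ^ m) \<le> real L ^ (L - 1) * real L ^ m"
    using one two by (intro mult_mono) auto
  then have "4 * (real (L - 1) ^ (L - 1) * (real m + 1) ^ m) \<le> C ^ m"
    by (simp add: C k' power_add)
  then have "(4 * (real (L - 1) ^ (L - 1) * (real m + 1) ^ m)) ^ N \<le> (C ^ m) ^ N"
    by (intro power_mono) auto
  then have slack: "4 ^ N * (real (L - 1) ^ ((L - 1) * N) * (real m + 1) ^ (m * N)) \<le> C ^ (m * N)"
    by (simp add: power_mult_distrib power_mult)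
  have "q ^ ?e * (2 ^ k * ((D * real (L - 1)) ^ ?e * (real m + 1) ^ (m * N)))
      = (q * D) ^ ?e * (2 ^ k * real (L - 1) ^ r) * (real (L - 1) ^ ((L - 1) * N) * (real m + 1) ^ (m * N))"
    by (simp add: power_mult_distrib power_add)
  also have "\<dots> \<le> C ^ ?e * (4 ^ N * q ^ ?e) * (real (L - 1) ^ ((L - 1) * N) * (real m + 1) ^ (m * N))"
  proof (rule mult_right_mono[OF mult_mono])
    show "(q * D) ^ ?e \<le> C ^ ?e" using D by (intro power_mono) auto
    have "2 ^ k * real (L - 1) ^ r \<le> 2 ^ k * real L ^ r" using L3 by (intro mult_left_mono power_mono) auto
    then show "2 ^ k * real (L - 1) ^ r \<le> 4 ^ N * q ^ ?e" by (rule order_trans[OF _ surplus])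
  qed (use C0 D in auto)
  also have "\<dots> = C ^ ?e * q ^ ?e * (4 ^ N * (real (L - 1) ^ ((L - 1) * N) * (real m + 1) ^ (m * N)))"
    by simp
  also have "\<dots> \<le> C ^ ?e * q ^ ?e * C ^ (m * N)"
    using slack C0 D by (intro mult_left_mono) auto
  also have "\<dots> = q ^ ?e * C ^ (k * N + r)" by (simp add: k' power_add algebra_simps)
  finally show ?thesis using D by simp
qed

lemma residue_class_card:
  assumes "bij_betw e I {..<n}" "i < (k::nat)"
  shows "n div k \<le> card {p \<in> I. e p mod k = i}" "card {p \<in> I. e p mod k = i} \<le> n div k + 1"
proof -
  let ?R = "{j. j < n \<and> j mod k = i}"
  have "e ` {p \<in> I. e p mod k = i} = ?R"
    using assms(1) unfolding bij_betw_def by (auto simp: image_iff set_eq_iff) (metis lessThan_iff)+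
  then have eq: "card {p \<in> I. e p mod k = i} = card ?R"
    using assms(1) by (metis (no_types, lifting) bij_betw_def card_image inj_on_subset mem_Collect_eq subsetI)
  have "(\<lambda>t. t * k + i) ` {..<n div k} \<subseteq> ?R"
  proof (clarsimp simp: assms(2))
    fix t assume "t < n div k"
    then have "(t + 1) * k \<le> n div k * k" by (intro mult_right_mono) auto
    also have "\<dots> \<le> n" by (simp add: div_times_less_eq_dividend)
    finally show "t * k + i < n" using assms(2) by (simp add: algebra_simps)
  qed
  moreover have "inj_on (\<lambda>t. t * k + i) {..<n div k}" using assms(2) by (auto intro: inj_onI)
  ultimately have "card {..<n div k} \<le> card ?R" by (intro card_inj_on_le) auto
  then show "n div k \<le> card {p \<in> I. e p mod k = i}" by (simp add: eq)
  have "inj_on (\<lambda>j. j div k) ?R" by (auto intro!: inj_onI) (metis div_mod_decomp)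
  moreover have "(\<lambda>j. j div k) ` ?R \<subseteq> {..n div k}" by (auto intro: div_le_mono)
  ultimately have "card ?R \<le> card {..n div k}" by (intro card_inj_on_le) auto
  then show "card {p \<in> I. e p mod k = i} \<le> n div k + 1" by (simp add: eq)
qed

text \<open>
  Since \<open>\<gamma> \<le> W\<close>, the product is largest if the arms outside \<open>S\<close> have the minimal size.
\<close>

lemma arms_product_le:
  fixes N k n m :: nat and x :: "nat \<Rightarrow> nat"
  assumes S: "S \<subseteq> {..<k}" "card S = k - m" "m \<le> k"
    and x: "\<And>i. i < k \<Longrightarrow> N \<le> x i" "(\<Sum>i<k. x i) = n"
    and \<gamma>: "0 \<le> \<gamma>" "\<gamma> \<le> (W::real)"
  shows "(\<Prod>i\<in>S. W ^ x i) * (\<Prod>i\<in>{..<k} - S. \<gamma> ^ x i) \<le> W ^ (n - m * N) * \<gamma> ^ (m * N)"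
proof -
  define b where "b = (\<Sum>i\<in>{..<k} - S. x i)"
  have ab: "(\<Sum>i\<in>S. x i) + b = n" using S x(2) sum.subset_diff[of S "{..<k}" x] by (simp add: b_def)
  have "card ({..<k} - S) = m"
    using S finite_subset[OF S(1)] by (simp add: card_Diff_subset)
  then have "m * N \<le> b"
    unfolding b_def using sum_bounded_below[of "{..<k} - S" N x] x(1) by auto
  then obtain t where t: "b = m * N + t" using le_Suc_ex by blast
  have "(\<Prod>i\<in>S. W ^ x i) * (\<Prod>i\<in>{..<k} - S. \<gamma> ^ x i) = W ^ (\<Sum>i\<in>S. x i) * \<gamma> ^ b"
    by (simp add: power_sum b_def)
  also have "\<dots> = W ^ (\<Sum>i\<in>S. x i) * \<gamma> ^ t * \<gamma> ^ (m * N)" by (simp add: t power_add)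
  also have "\<dots> \<le> W ^ (\<Sum>i\<in>S. x i) * W ^ t * \<gamma> ^ (m * N)"
    using \<gamma> by (intro mult_right_mono mult_left_mono power_mono) auto
  also have "\<dots> = W ^ ((\<Sum>i\<in>S. x i) + t) * \<gamma> ^ (m * N)" by (simp only: power_add)
  also have "(\<Sum>i\<in>S. x i) + t = n - m * N" using ab t by linarith
  finally show ?thesis .
qed

section \<open>The recursive construction and the bound\<close>

text \<open>
  Induction on the number of labels, which are dealt out to the \<open>k\<close> arms as evenly as possible.
  For few points, at most \<open>L\<^sup>2\<close>, every configuration will do. The configurations of the arms are
  perturbed so that the labels of an arm have distinct positions.
\<close>

lemma low_potential_configuration:
  fixes C :: real and d m :: nat and I :: "'p set"
  defines "k \<equiv> d + 2 * m - 1"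
  assumes d: "d \<ge> 3" and m: "m \<ge> 1" and C: "C ^ m = real (d + m) ^ k" "real (d + m) ^ 2 \<le> C"
    and I: "finite I"
  shows "\<exists>h B. potential (real m + 1) (hidden d h) I B \<and> B I \<le> C ^ card I"
  using I
proof (induction "card I" arbitrary: I rule: less_induct)
  case less
  define L where "L = d + m"
  define n where "n = card I"
  have L: "4 \<le> L" "m + 2 \<le> L" and k: "k = L - 1 + m" "4 \<le> k" "m < k" "k - m = L - 1" "k \<le> 2 * L"
    using d m by (auto simp: L_def k_def)
  have LC: "real L ^ 2 \<le> C" using C(2) by (simp only: L_def)
  have CL: "C ^ m = real L ^ k" using C(1) by (simp only: L_def)
  have mL: "real m + 1 \<le> real L" using L by simp
  have LL: "real L \<le> real L ^ 2 / 2" using L by (simp add: power2_eq_square)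
  show ?case
  proof (cases "n \<le> L\<^sup>2")
    case True
    then have "real n \<le> real L ^ 2" by (metis of_nat_le_iff of_nat_power)
    then have "potential (real m + 1) (hidden d (\<lambda>_ _. 0)) I (\<lambda>Q. (real L ^ 2) ^ card Q)"
      using less.prems mL LL by (intro potential_power) (auto simp: n_def)
    moreover have "(real L ^ 2) ^ card I \<le> C ^ card I" using LC by (intro power_mono) auto
    ultimately show ?thesis by blast
  next
    case False
    define N r where "N = n div k" and "r = n mod k"
    have n: "n = k * N + r" "r < k" using k by (auto simp: N_def r_def)
    have N1: "1 \<le> N"
    proof -
      have "4 * L \<le> L * L" using L by (intro mult_right_mono) auto
      then have "k \<le> n" using False k(5) unfolding power2_eq_square by linarith
      then show ?thesis using k by (simp add: N_def Suc_le_eq div_greater_zero_iff)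
    qed
    obtain e where e: "bij_betw e I {..<n}"
      using ex_bij_betw_finite_nat[OF less.prems] by (auto simp: n_def atLeast0LessThan)
    define c where "c p = e p mod k" for p
    define arm where "arm i = {p \<in> I. c p = i}" for i
    have arm: "N \<le> card (arm i)" "card (arm i) \<le> N + 1" if "i < k" for i
      using residue_class_card[OF e that] by (auto simp: N_def arm_def c_def)
    have finarm: "finite (arm i)" for i using less.prems by (simp add: arm_def)
    have cI: "c ` I \<subseteq> {..<k}" using k by (auto simp: c_def)
    have total: "(\<Sum>i<k. card (arm i)) = n"
    proof -
      have "n = (\<Sum>p\<in>I. 1)" by (simp add: n_def)
      also have "\<dots> = (\<Sum>i<k. \<Sum>p\<in>{p \<in> I. c p = i}. 1)"
        using less.prems cI by (intro sum.group[symmetric]) auto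
      finally show ?thesis by (simp add: arm_def)
    qed
    obtain D q :: real where D: "real m + 1 \<le> D" "0 < q" "q * D \<le> C"
      and surplus: "2 ^ k * real L ^ r \<le> 4 ^ N * q ^ ((L - 1) * N + r)"
      and base: "\<And>i. i < k \<Longrightarrow> \<exists>h B. potential (real m + 1) (hidden d h) (arm i) B \<and>
        B (arm i) \<le> D ^ card (arm i)"
    proof -
      note surplus = surplus_absorbed[OF m d L_def k_def[THEN meta_eq_to_obj_eq] n(2), of N]
      have small: "\<exists>h B. potential (real m + 1) (hidden d h) (arm i) B \<and> B (arm i) \<le> D ^ card (arm i)"
        if "real (N + 1) \<le> D" "real m + 1 \<le> D" "i < k" for D i
      proof -
        have "real (card (arm i)) \<le> D" using arm(2)[OF that(3)] that(1) by linarith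
        then have "potential (real m + 1) (hidden d (\<lambda>_ _. 0)) (arm i) (\<lambda>Q. D ^ card Q)"
          using that finarm by (intro potential_power) auto
        then show ?thesis by blast
      qed
      (* Small arms use their trivial potential; the induction hypothesis is used only if the arms
      are large enough for the gain 4 ^ N alone to suffice. *)
      consider "N + 1 \<le> L" | "L \<le> N" "2 * (N + 1) \<le> L\<^sup>2" | "L\<^sup>2 < 2 * (N + 1)" by linarith
      then show thesis
      proof cases
        case 1
        show thesis
        proof (rule that[of "real L" "real L"])
          show "real L * real L \<le> C" using LC by (simp add: power2_eq_square)
        qed (use 1 mL L surplus(1)[OF N1] small[of "real L"] in auto)
      next
        case 2
        have "2 * real (N + 1) \<le> real L ^ 2"
          using 2(2) by (metis of_nat_le_iff of_nat_mult of_nat_numeral of_nat_power)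
        then have "real (N + 1) \<le> real L ^ 2 / 2" by simp
        then show thesis
          using mL LL LC surplus(2)[OF 2(1)] small[of "real L ^ 2 / 2"] by (intro that[of "real L ^ 2 / 2" 2]) auto
      next
        case 3
        have "card (arm i) < card I" if "i < k" for i
        proof -
          have "4 * N \<le> k * N" using k by (intro mult_right_mono) auto
          then show ?thesis using arm(2)[OF that] n(1) N1 unfolding n_def by linarith
        qed
        then show thesis
          using less.hyps finarm mL LL LC surplus(3)[OF 3] by (intro that[of C 1]) auto
      qed
    qed
    have "\<exists>h B. potential (real m + 1) (hidden d h) (arm i) B \<and> B (arm i) \<le> D ^ card (arm i) \<and>
        inj_on h (arm i) \<and> h ` arm i \<subseteq> Rn d" if ik: "i < k" for i
    proof -
      obtain h B where hB: "potential (real m + 1) (hidden d h) (arm i) B" "B (arm i) \<le> D ^ card (arm i)"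
        using base[OF ik] by blast
      obtain g where g: "inj_on g (arm i)" "general_position d (g ` arm i)"
        "\<And>Q p. Q \<subseteq> arm i \<Longrightarrow> p \<in> Q \<Longrightarrow> hidden d h Q p \<Longrightarrow> hidden d g Q p"
        using general_position_perturbation[OF finarm[of i], where d = d and f = h] d by auto
      have "potential (real m + 1) (hidden d g) (arm i) B"
        by (rule potential_hidden_mono[OF hB(1) finarm _ g(3)]) auto
      then show ?thesis using g hB(2) unfolding general_position_def by blast
    qed
    then have "\<forall>i\<in>{..<k}. \<exists>hB. potential (real m + 1) (hidden d (fst hB)) (arm i) (snd hB) \<and>
        snd hB (arm i) \<le> D ^ card (arm i) \<and> inj_on (fst hB) (arm i) \<and> fst hB ` arm i \<subseteq> Rn d"
      by fastforce
    from bchoice[OF this] obtain hB where hB: "\<forall>i\<in>{..<k}.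
        potential (real m + 1) (hidden d (fst (hB i))) (arm i) (snd (hB i)) \<and>
        snd (hB i) (arm i) \<le> D ^ card (arm i) \<and> inj_on (fst (hB i)) (arm i) \<and> fst (hB i) ` arm i \<subseteq> Rn d" ..
    define hs Bs where "hs i = fst (hB i)" and "Bs i = snd (hB i)" for i
    have hs: "\<And>i. i < k \<Longrightarrow> potential (real m + 1) (hidden d (hs i)) (arm i) (Bs i)"
        "\<And>i. i < k \<Longrightarrow> Bs i (arm i) \<le> D ^ card (arm i)"
        "\<And>i. i < k \<Longrightarrow> inj_on (hs i) (arm i)" "\<And>i. i < k \<Longrightarrow> hs i ` arm i \<subseteq> Rn d"
      using hB by (auto simp: hs_def Bs_def)
    define h where "h p = hs (c p) p" for p
    have h_inj: "\<exists>i<d. h p i \<noteq> h q i" if pq: "p \<in> I" "q \<in> I" "c p = c q" "p \<noteq> q" for p q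
    proof (rule ccontr)
      assume same: "\<not> ?thesis"
      have ck: "c p < k" using cI pq by auto
      have mem: "p \<in> arm (c p)" "q \<in> arm (c p)" using pq by (auto simp: arm_def)
      then have "hs (c p) p \<in> Rn d" "hs (c p) q \<in> Rn d" using hs(4)[OF ck] by auto
      then have "hs (c p) p j = hs (c p) q j" for j
        using same pq(3) by (cases "j < d") (auto simp: Rn_def h_def)
      then have "hs (c p) p = hs (c p) q" by blast
      then show False using inj_onD[OF hs(3)[OF ck]] mem pq by blast
    qed
    have dir: "m \<le> card {i. i < k \<and> 0 < dot d a (\<lambda>j. (-1) ^ i * real i ^ j)}"
      if "\<exists>j<d. a j \<noteq> 0" for a
      using gale_directions[OF that m] by (simp only: k_def)
    have "\<exists>F. (\<forall>Q\<subseteq>I. \<forall>p\<in>Q. hidden d h {q \<in> Q. c q = c p} p \<longrightarrow> hidden d F Q p) \<and>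
      (\<forall>Q\<subseteq>I. k - m < card (c ` Q) \<longrightarrow>
        (\<forall>p\<in>Q. \<forall>q\<in>Q. p \<noteq> q \<and> c p = c q \<longrightarrow> hidden d F Q p \<or> hidden d F Q q))"
      by (rule arms_configuration[OF less.prems cI m less_imp_le[OF k(3)] dir h_inj])
    then obtain F where
      Fa: "\<forall>Q\<subseteq>I. \<forall>p\<in>Q. hidden d h {q \<in> Q. c q = c p} p \<longrightarrow> hidden d F Q p"
      and Fb: "\<forall>Q\<subseteq>I. k - m < card (c ` Q) \<longrightarrow>
        (\<forall>p\<in>Q. \<forall>q\<in>Q. p \<noteq> q \<and> c p = c q \<longrightarrow> hidden d F Q p \<or> hidden d F Q q)"
      by (elim exE conjE)
    have F2: "hidden d F Q p \<or> hidden d F Q q"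
      if "Q \<subseteq> I" "k - m < card (c ` Q)" "p \<in> Q" "q \<in> Q" "p \<noteq> q" "c p = c q" for Q p q
      using Fb that by blast
    have F1: "hidden d F Q p"
      if "Q \<subseteq> I" "p \<in> Q" "hidden d (hs (c p)) {q \<in> Q. c q = c p} p" for Q p
    proof -
      have "hidden d h {q \<in> Q. c q = c p} p" using that(3) unfolding hidden_def h_def by auto
      then show ?thesis using Fa that(1,2) by blast
    qed
    have "\<exists>B. potential (real m + 1) (hidden d F) I B \<and>
      B I \<le> (\<Sum>S | S \<subseteq> {..<k} \<and> card S = k - m.
        (\<Prod>i\<in>S. Bs i (arm i) * real (k - m) ^ card (arm i)) *
        (\<Prod>i\<in>{..<k} - S. (real m + 1) ^ card (arm i)))"
      unfolding arm_def
      by (rule potential_merge[OF less.prems cI k(3) hs(1)[unfolded arm_def] F1 F2])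
    then
    obtain B where B: "potential (real m + 1) (hidden d F) I B"
      and BI: "B I \<le> (\<Sum>S | S \<subseteq> {..<k} \<and> card S = k - m.
        (\<Prod>i\<in>S. Bs i (arm i) * real (k - m) ^ card (arm i)) *
        (\<Prod>i\<in>{..<k} - S. (real m + 1) ^ card (arm i)))"
      by blast
    define W where "W = D * real (L - 1)"
    have w: "1 \<le> real (L - 1)" using L by simp
    have \<gamma>W: "real m + 1 \<le> W"
    proof -
      have "(real m + 1) * 1 \<le> W" unfolding W_def using D w by (intro mult_mono) auto
      then show ?thesis by simp
    qed
    have "k * N = (L - 1) * N + m * N" by (simp only: k(1) distrib_right)
    then have expo: "n - m * N = (L - 1) * N + r" using n(1) by linarith
    have term_le: "(\<Prod>i\<in>S. Bs i (arm i) * real (k - m) ^ card (arm i)) *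
        (\<Prod>i\<in>{..<k} - S. (real m + 1) ^ card (arm i)) \<le> W ^ ((L - 1) * N + r) * (real m + 1) ^ (m * N)"
      if S: "S \<subseteq> {..<k}" "card S = k - m" for S
    proof -
      have "0 < Bs i (arm i)" if "i < k" for i
        using potential_pos[OF hs(1)[OF that] finarm] by simp
      then have "(\<Prod>i\<in>S. Bs i (arm i) * real (k - m) ^ card (arm i)) \<le> (\<Prod>i\<in>S. W ^ card (arm i))"
        using S hs(2) unfolding k(4) W_def power_mult_distrib
        by (intro prod_mono conjI mult_nonneg_nonneg mult_right_mono) (auto intro: less_imp_le)
      then have "(\<Prod>i\<in>S. Bs i (arm i) * real (k - m) ^ card (arm i)) *
          (\<Prod>i\<in>{..<k} - S. (real m + 1) ^ card (arm i))
          \<le> (\<Prod>i\<in>S. W ^ card (arm i)) * (\<Prod>i\<in>{..<k} - S. (real m + 1) ^ card (arm i))"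
        by (intro mult_right_mono prod_nonneg) auto
      also have "\<dots> \<le> W ^ (n - m * N) * (real m + 1) ^ (m * N)"
        using S k arm(1) total \<gamma>W by (intro arms_product_le) auto
      finally show ?thesis by (simp only: expo)
    qed
    let ?SS = "{S. S \<subseteq> {..<k} \<and> card S = k - m}"
    have cardSS: "card ?SS \<le> 2 ^ k"
      using card_mono[of "Pow {..<k}" ?SS] by (auto simp: card_Pow)
    have "B I \<le> (\<Sum>S\<in>?SS. W ^ ((L - 1) * N + r) * (real m + 1) ^ (m * N))"
      using BI by (rule order_trans) (intro sum_mono, use term_le in auto)
    also have "\<dots> = real (card ?SS) * (W ^ ((L - 1) * N + r) * (real m + 1) ^ (m * N))" by simp
    also have "\<dots> \<le> 2 ^ k * (W ^ ((L - 1) * N + r) * (real m + 1) ^ (m * N))"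
    proof (rule mult_right_mono)
      show "real (card ?SS) \<le> 2 ^ k" using cardSS by (metis of_nat_le_iff of_nat_numeral of_nat_power)
      show "0 \<le> W ^ ((L - 1) * N + r) * (real m + 1) ^ (m * N)" using \<gamma>W by simp
    qed
    also have "\<dots> \<le> C ^ (k * N + r)"
      unfolding W_def using D(1)
      by (intro arms_bound_numeric[OF m d L_def k_def[THEN meta_eq_to_obj_eq] CL _ D(2,3) surplus]) simp
    finally have "B I \<le> C ^ card I" unfolding n(1)[symmetric] n_def .
    then show ?thesis using B by blast
  qed
qed

lemma peelings_le_potential:
  assumes I: "finite I" "inj_on g I" "g ` I \<subseteq> Rn d" "d \<ge> 1"
    and pot: "potential \<gamma> (hidden d g) I B" and Q: "Q \<subseteq> I"
  shows "real (num_peelings (g ` Q)) \<le> B Q"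
proof -
  have "finite Q" using I Q finite_subset by blast
  then show ?thesis using Q
  proof (induction Q rule: finite_psubset_induct)
    case (psubset Q)
    let ?PS = "\<lambda>Q. {ps. peeling_sequence (g ` Q) ps}"
    let ?N = "{x \<in> Q. \<not> hidden d g Q x}"
    show ?case
    proof (cases "Q = {}")
      case True
      have "?PS {} \<subseteq> {[]}" by (auto elim: peeling_sequence.cases simp: extreme_point_of_def)
      then have "card (?PS {}) \<le> 1" using card_mono[of "{[]}" "?PS {}"] by simp
      then show ?thesis using True pot by (simp add: potential_def num_peelings_def)
    next
      case False
      have inj: "inj_on g Q" using I(2) psubset.prems inj_on_subset by blast
      have "?PS Q \<subseteq> (\<Union>x\<in>?N. (#) (g x) ` ?PS (Q - {x}))"
      proof
        fix ps assume "ps \<in> ?PS Q"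
        then have "peeling_sequence (g ` Q) ps" by simp
        then show "ps \<in> (\<Union>x\<in>?N. (#) (g x) ` ?PS (Q - {x}))"
        proof cases
          case 1
          then show ?thesis using False by simp
        next
          case (2 y ps')
          then obtain x where x: "x \<in> Q" "y = g x" using extreme_point_of_convex_hull by blast
          have "g ` Q - {g x} = g ` (Q - {x})" using inj x by (auto dest: inj_onD)
          moreover have "\<not> hidden d g Q x"
            using extreme_point_not_hidden[OF psubset.hyps x(1) inj _ I(4)] 2 x I(3) psubset.prems by auto
          ultimately show ?thesis using 2 x by auto
        qed
      qed
      then have "card (?PS Q) \<le> card (\<Union>x\<in>?N. (#) (g x) ` ?PS (Q - {x}))"
        using psubset.hyps by (intro card_mono finite_UN_I finite_imageI finite_peeling_sequences) auto
      also have "\<dots> \<le> (\<Sum>x\<in>?N. card ((#) (g x) ` ?PS (Q - {x})))"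
        using psubset.hyps by (intro card_UN_le) auto
      also have "\<dots> = (\<Sum>x\<in>?N. num_peelings (g ` (Q - {x})))"
        by (simp add: card_image num_peelings_def)
      finally have "num_peelings (g ` Q) \<le> (\<Sum>x\<in>?N. num_peelings (g ` (Q - {x})))"
        by (simp only: num_peelings_def)
      then have "real (num_peelings (g ` Q)) \<le> real (\<Sum>x\<in>?N. num_peelings (g ` (Q - {x})))"
        by (simp only: of_nat_le_iff)
      also have "\<dots> = (\<Sum>x\<in>?N. real (num_peelings (g ` (Q - {x}))))" by simp
      also have "\<dots> \<le> (\<Sum>x\<in>?N. B (Q - {x}))"
        using psubset by (intro sum_mono psubset.IH) auto
      also have "\<dots> \<le> B Q" using pot psubset.prems by (simp add: potential_def)
      finally show ?thesis .
    qed
  qed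
qed

lemma min_peelings_le:
  assumes d: "d \<ge> 3" and m: "m \<ge> 1"
  shows "real (min_peelings d n)
    \<le> real (d + m) powr ((real d + 2 * real m - 1) / real m * real n)"
proof -
  define k where "k = d + 2 * m - 1"
  define x where "x = (real d + 2 * real m - 1) / real m"
  define C where "C = real (d + m) powr x"
  have x: "x * real m = real k" "2 \<le> x"
    using d m by (auto simp: x_def k_def of_nat_diff le_divide_eq)
  have L: "1 \<le> real (d + m)" "0 < real (d + m)" using d by auto
  have pow: "C ^ j = real (d + m) powr (x * real j)" for j
    unfolding C_def using L by (simp add: powr_powr flip: powr_realpow)
  have "C ^ m = real (d + m) ^ k"
    unfolding pow x(1) using L by (simp only: powr_realpow)
  moreover have "real (d + m) ^ 2 \<le> C"
  proof -
    have "real (d + m) ^ 2 = real (d + m) powr 2" using L by (simp only: powr_numeral less_imp_le)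
    also have "\<dots> \<le> C" unfolding C_def using L x(2) by (intro powr_mono)
    finally show ?thesis .
  qed
  ultimately obtain h B where hB: "potential (real m + 1) (hidden d h) {..<n} B" "B {..<n} \<le> C ^ n"
    using low_potential_configuration[OF d m, of C "{..<n}"] by (auto simp: k_def)
  obtain g where g: "inj_on g {..<n}" "general_position d (g ` {..<n})"
    "\<And>Q p. Q \<subseteq> {..<n} \<Longrightarrow> p \<in> Q \<Longrightarrow> hidden d h Q p \<Longrightarrow> hidden d g Q p"
    using general_position_perturbation[of "{..<n}" d h] d by auto
  have pot: "potential (real m + 1) (hidden d g) {..<n} B"
    by (rule potential_hidden_mono[OF hB(1) _ _ g(3)]) auto
  have "min_peelings d n \<le> num_peelings (g ` {..<n})"
    unfolding min_peelings_def using g by (intro cINF_lower) (auto simp: card_image)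
  also have "real (num_peelings (g ` {..<n})) \<le> B {..<n}"
    using g(1,2) d by (intro peelings_le_potential[OF _ _ _ _ pot]) (auto simp: general_position_def)
  also have "\<dots> \<le> C ^ n" by (rule hB(2))
  finally show ?thesis unfolding pow x_def by simp
qed

theorem theorem2:
  shows "\<exists>c::real. \<forall>d m n::nat. d \<ge> 3 \<longrightarrow> m \<ge> 1 \<longrightarrow> n \<ge> 2 \<longrightarrow>
    real (min_peelings d n)
      \<le> c * real (d + m) powr ((real d + 2 * real m - 1) / real m * real n)"
  using min_peelings_le by (intro exI[of _ 1]) simp

end
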